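(* Let $n\in\mathbb{N}$ and $j\in\mathbb{Z}$. Then $\Phi_n:V_j^+\oplus\mathcal{H}(V_j^+)\to L^2(\mathbb{R})$ is an isometry: for all $g\in V_j^+\oplus\mathcal{H}(V_j^+)$, $\langle\Phi_n g,\Phi_n g\rangle=\langle g,g\rangle$.
   Context: $c_n(\eta)=\sum_{l\ge0}\frac{(-1)^l n}{(2n)^{2l+\frac{1}{2n}}\Gamma(l+\frac{1}{2n})l!}\eta^{2nl}$; $\mathcal{H}$ is the Hilbert transform ($\mathcal{H}f(x)=\frac1\pi\,\mathrm{p.v.}\int\frac{f(t)}{x-t}dt$ on $L^2(\mathbb{R})$, unitary, extended to tempered distributions); $s_n=-\mathcal{H}c_n$ (odd function), $\varphi_n=c_n+is_n$. Let $\phi=\mathbf{1}_{[0,1]}$, $\phi_{j,k}(t)=\phi(2^jt-k)$, $V_j$ the finite linear span of $\{\phi_{j,k}\}_{k\in\mathbb{Z}}$, $V_j^+$ its even elements, $\mathcal{H}(V_j^+)$ the image under $\mathcal{H}$. $\Phi_n g(\omega)=\int\varphi_n(\omega t)g(t)\,dt$, which for $g\in V_j^+$ is $\int c_n(\omega t)g(t)\,dt$ and for $g\in\mathcal{H}(V_j^+)$ is $i\int s_n(\omega t)g(t)\,dt$ in the distributional sense, equal to $i\,\operatorname{sgn}(\omega)\int c_n(\omega t)(\mathcal{H}g)(t)\,dt$; $\Phi_n$ is extended linearly to the direct sum. *)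

theory Defs
  imports "HOL-Analysis.Analysis"
begin

definition c_fun :: "nat \<Rightarrow> real \<Rightarrow> real" where
  "c_fun n \<eta> = (\<Sum>l. ((-1) ^ l * real n /
      ((2 * real n) powr (2 * real l + 1 / (2 * real n)) * Gamma (real l + 1 / (2 * real n)) * fact l))
      * \<eta> ^ (2 * n * l))"

definition hilbert :: "(real \<Rightarrow> complex) \<Rightarrow> real \<Rightarrow> complex" where
  "hilbert f x = Lim (at_right 0)
     (\<lambda>\<epsilon>::real. complex_of_real (1 / pi) *
        (LINT t : {t. \<epsilon> < \<bar>x - t\<bar>} | lborel. f t / complex_of_real (x - t)))"

definition phi_jk :: "int \<Rightarrow> int \<Rightarrow> real \<Rightarrow> real" where
  "phi_jk j k t = (if 0 \<le> (2::real) powi j * t - real_of_int k \<and> (2::real) powi j * t - real_of_int k \<le> 1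
                   then 1 else 0)"

definition V_space :: "int \<Rightarrow> (real \<Rightarrow> complex) set" where
  "V_space j = {f. \<exists>K a. finite K \<and> (\<forall>t. f t = (\<Sum>k\<in>K. a k * complex_of_real (phi_jk j k t)))}"

definition V_plus :: "int \<Rightarrow> (real \<Rightarrow> complex) set" where
  "V_plus j = {f \<in> V_space j. \<forall>t. f (- t) = f t}"

text \<open>Phi_n on the direct sum, given the (unique) decomposition g = f + g2 with f in V_j^+ and
  g2 in H(V_j^+): Phi_n f (w) = int c_n(w t) f(t) dt and
  Phi_n g2 (w) = i sgn(w) int c_n(w t) (H g2)(t) dt.\<close>
definition Phi_op :: "nat \<Rightarrow> (real \<Rightarrow> complex) \<Rightarrow> (real \<Rightarrow> complex) \<Rightarrow> real \<Rightarrow> complex" where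
  "Phi_op n f g2 \<omega> =
     (LINT t | lborel. complex_of_real (c_fun n (\<omega> * t)) * f t)
     + \<i> * complex_of_real (sgn \<omega>) *
       (LINT t | lborel. complex_of_real (c_fun n (\<omega> * t)) * hilbert g2 t)"

end

(* Both halves are isometric, and they are orthogonal by parity.

   The transform with kernel c_n maps exp(-s t^(2n)) to (2ns)^(-1/(2n)) exp(-w^(2n) / (4 n^2 s)):
   integrate the series of c_n termwise against Gamma integrals.  Comparing inner products, the
   transform is isometric on the span of the powers of y = exp(-t^(2n)).  An even step function is a
   pointwise limit of polynomials in y without constant term, all dominated by a multiple of y
   (Weierstrass in the variable y on [0,1]); dominated convergence and Fatou's lemma extend the
   isometry to it.

   The Hilbert transform of the indicator of [a,b] is ln |(x-a)/(x-b)| / pi.  Everything about it that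
   is needed follows from the single integral of ln |(1+v)/(1-v)| / v over the line, which is pi^2:
   it shows H(H h) = -h away from the jumps of a step function h, and Fubini's theorem with
   truncated kernels turns this into the equality of the norms of H h and h.

   Hence Phi_n(f + H h) is the even function C f minus i sgn(w) times the even function C h, where C
   is the transform with kernel c_n, while f is even and H h is odd. *)
theory Submission
  imports Defs
begin

section \<open>The logarithmic kernel\<close>

text \<open>Neither transform is available as an operator on L^2. \<open>hilbert\<close> is a
  pointwise limit, with an unspecified value wherever the limit does not exist, and
  \<open>Phi_op\<close> is a plain integral against a power series whose alternating terms grow
  before they shrink. So identities for Hilbert transforms are stated off the finite set of interval
  endpoints, and the kernel c_n is controlled only through its absolute integrability against exp(-s
  t^(2n)), never through its size at infinity. The constant pi^2 arises as follows. On (0,1) the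
  logarithmic kernel is the sum of 2 v^(2k) / (2k+1), and the symmetries v -> -v and v -> 1/v carry
  this to the other three pieces of the line. Each piece contributes 2 times the sum of 1 /
  (2k+1)^2, that is pi^2/4. Since every Hilbert transform carries a factor 1/pi, the total pi^2 is
  exactly what two of them cancel.\<close>

lemma nn_integral_even:
  fixes f :: "real \<Rightarrow> ennreal"
  assumes [measurable]: "f \<in> borel_measurable borel" and "\<And>t. f (- t) = f t"
  shows "(\<integral>\<^sup>+t. f t \<partial>lborel) = 2 * (\<integral>\<^sup>+t. f t * indicator {0<..} t \<partial>lborel)"
proof -
  have "(\<integral>\<^sup>+t. f t \<partial>lborel) = (\<integral>\<^sup>+t. f t * indicator {0<..} t + f t * indicator {..<0} t \<partial>lborel)"
    by (intro nn_integral_cong_AE, use AE_lborel_singleton[of "0::real"] in eventually_elim)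
       (auto simp: indicator_def)
  also have "\<dots> = (\<integral>\<^sup>+t. f t * indicator {0<..} t \<partial>lborel) + (\<integral>\<^sup>+t. f t * indicator {..<0} t \<partial>lborel)"
    by (intro nn_integral_add) simp_all
  also have "(\<integral>\<^sup>+t. f t * indicator {..<0} t \<partial>lborel) = (\<integral>\<^sup>+t. f t * indicator {0<..} t \<partial>lborel)"
    by (subst nn_integral_real_affine[where c = "-1" and t = 0])
       (auto simp: assms(2) indicator_def intro!: nn_integral_cong)
  finally show ?thesis by (simp add: mult_2)
qed

text \<open>Dividing by v makes ln |(1+v)/(1-v)| integrable: the numerator behaves like 2/v at
  infinity and like 2v at 0. The value at 0 is 0 by division by zero, and 1 and -1 use ln 0 = 0;
  these single points do not affect the integral.\<close>

definition log_kernel :: "real \<Rightarrow> real" where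
  "log_kernel v = (ln (\<bar>1 + v\<bar>) - ln (\<bar>1 - v\<bar>)) / v"

lemma log_kernel_borel [measurable]: "log_kernel \<in> borel_measurable borel"
  unfolding log_kernel_def by measurable

lemma log_kernel_minus: "log_kernel (- v) = log_kernel v"
  by (cases "v = 0") (simp_all add: log_kernel_def field_simps)

lemma log_kernel_nonneg: "0 \<le> log_kernel v"
proof -
  have pos: "0 \<le> log_kernel v" if "v > 0" for v
  proof (cases "v = 1")
    case False
    then have "ln \<bar>1 - v\<bar> \<le> ln \<bar>1 + v\<bar>" using that by (intro ln_mono) auto
    then show ?thesis using that by (simp add: log_kernel_def)
  qed (simp add: log_kernel_def)
  consider "v > 0" | "v = 0" | "- v > 0" by linarith
  then show ?thesis
    by cases (use pos[of v] pos[of "-v"] in \<open>auto simp: log_kernel_minus log_kernel_def[of 0]\<close>)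
qed

text \<open>The even squares contribute a quarter of the Basel series, which leaves pi^2/6 -
  pi^2/24.\<close>

lemma odd_inverse_squares_sums: "(\<lambda>k. 1 / real (2 * k + 1) ^ 2) sums (pi\<^sup>2 / 8)"
proof -
  have all: "(\<lambda>n. 1 / real (n + 1) ^ 2) sums (pi\<^sup>2 / 6)"
    using inverse_squares_sums by simp
  have "(\<lambda>n. (1 / 4) * (1 / real (n + 1) ^ 2)) sums ((1 / 4) * (pi\<^sup>2 / 6))"
    by (intro sums_mult all)
  moreover have "(1 / 4) * (1 / real (k + 1) ^ 2) = 1 / real (2 * k + 2) ^ 2" for k
    by (simp add: divide_simps power2_eq_square) (simp add: algebra_simps)
  ultimately have even: "(\<lambda>k. 1 / real (2 * k + 2) ^ 2) sums (pi\<^sup>2 / 24)"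
    by simp
  have "(\<lambda>k. \<Sum>i\<in>{k * 2..<k * 2 + 2}. 1 / real (i + 1) ^ 2) sums (pi\<^sup>2 / 6)"
    using sums_group[OF all, of 2] by simp
  moreover have "(\<Sum>i\<in>{k * 2..<k * 2 + 2}. 1 / real (i + 1) ^ 2)
      = 1 / real (2 * k + 1) ^ 2 + 1 / real (2 * k + 2) ^ 2" for k
  proof -
    have "{k * 2..<k * 2 + 2} = {2 * k, 2 * k + 1}" by auto
    then show ?thesis by (simp add: algebra_simps)
  qed
  ultimately have "(\<lambda>k. 1 / real (2 * k + 1) ^ 2 + 1 / real (2 * k + 2) ^ 2) sums (pi\<^sup>2 / 6)"
    by simp
  from sums_diff[OF this even] show ?thesis by (simp add: field_simps)
qed

lemma log_kernel_sums_below_1: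
  assumes "0 < v" "v < 1"
  shows "(\<lambda>k. 2 * v ^ (2 * k) / real (2 * k + 1)) sums log_kernel v"
proof -
  have "(\<lambda>k. 2 * (((1 + v) / (1 - v) - 1) / ((1 + v) / (1 - v) + 1)) ^ (2 * k + 1) / of_nat (2 * k + 1))
     sums ln ((1 + v) / (1 - v))"
    using assms by (intro ln_series_quadratic) simp
  moreover have "((1 + v) / (1 - v) - 1) / ((1 + v) / (1 - v) + 1) = v"
    using assms by (simp add: divide_simps)
  ultimately have "(\<lambda>k. 2 * v ^ (2 * k + 1) / real (2 * k + 1)) sums ln ((1 + v) / (1 - v))"
    by simp
  from sums_divide[OF this, of v] show ?thesis
    using assms by (simp add: log_kernel_def ln_div)
qed

text \<open>The inversion v -> 1/v leads back to the range below 1, since log_kernel(1/v) / v^2 =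
  log_kernel(v).\<close>

lemma log_kernel_sums_above_1:
  assumes "1 < v"
  shows "(\<lambda>k. 2 / (real (2 * k + 1) * v ^ (2 * k + 2))) sums log_kernel v"
proof -
  have "log_kernel (1 / v) / v\<^sup>2 = log_kernel v"
  proof -
    have "\<bar>1 + 1 / v\<bar> = (1 + v) / v" "\<bar>1 - 1 / v\<bar> = (v - 1) / v" "\<bar>1 - v\<bar> = v - 1"
      using assms by (auto simp: field_simps abs_if)
    then show ?thesis
      using assms by (simp add: log_kernel_def ln_div power2_eq_square)
  qed
  moreover have "(\<lambda>k. (2 * (1 / v) ^ (2 * k) / real (2 * k + 1)) / v\<^sup>2) sums (log_kernel (1 / v) / v\<^sup>2)"
    using assms by (intro sums_divide log_kernel_sums_below_1) auto
  moreover have "(2 * (1 / v) ^ (2 * k) / real (2 * k + 1)) / v\<^sup>2 = 2 / (real (2 * k + 1) * v ^ (2 * k + 2))" for k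
    using assms by (simp add: power_divide power_add power2_eq_square mult_ac)
  ultimately show ?thesis by simp
qed

text \<open>This is the common part of the two ranges {0..1} and {1..}: the terms are nonnegative,
  so sum and integral may be exchanged without a further estimate. The expansion is required only
  almost everywhere because both series diverge at v = 1, and at v = 0 the series gives 2 while
  \<open>log_kernel\<close> gives 0.\<close>

lemma nn_integral_log_kernel_series:
  assumes [measurable]: "A \<in> sets borel" and "\<And>k. f k \<in> borel_measurable borel"
    and "\<And>k v. v \<in> A \<Longrightarrow> 0 \<le> f k v"
    and "AE v in lborel. v \<in> A \<longrightarrow> (\<lambda>k. f k v) sums log_kernel v"
    and "\<And>k. (\<integral>\<^sup>+ v. ennreal (f k v) * indicator A v \<partial>lborel) = ennreal (2 / real (2 * k + 1) ^ 2)"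
  shows "(\<integral>\<^sup>+ v. ennreal (log_kernel v) * indicator A v \<partial>lborel) = ennreal (pi\<^sup>2 / 4)"
proof -
  note [measurable] = assms(2)
  have "(\<integral>\<^sup>+ v. ennreal (log_kernel v) * indicator A v \<partial>lborel)
      = (\<integral>\<^sup>+ v. (\<Sum>k. ennreal (f k v) * indicator A v) \<partial>lborel)"
  proof (intro nn_integral_cong_AE, use assms(4) in eventually_elim)
    case (elim v)
    show ?case
    proof (cases "v \<in> A")
      case True
      then have "(\<Sum>k. ennreal (f k v)) = ennreal (log_kernel v)"
        using elim assms(3) by (intro suminf_ennreal_eq) auto
      then show ?thesis using True by simp
    qed simp
  qed
  also have "\<dots> = (\<Sum>k. (\<integral>\<^sup>+ v. ennreal (f k v) * indicator A v \<partial>lborel))"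
    by (intro nn_integral_suminf) simp
  also have "\<dots> = (\<Sum>k. ennreal (2 * (1 / real (2 * k + 1) ^ 2)))"
    by (simp add: assms(5))
  also have "\<dots> = ennreal (2 * (pi\<^sup>2 / 8))"
    by (intro suminf_ennreal_eq sums_mult odd_inverse_squares_sums) auto
  finally show ?thesis by simp
qed

lemma nn_integral_log_kernel_below_1:
  "(\<integral>\<^sup>+ v. ennreal (log_kernel v) * indicator {0..1} v \<partial>lborel) = ennreal (pi\<^sup>2 / 4)"
proof (rule nn_integral_log_kernel_series[where f = "\<lambda>k v. 2 * v ^ (2 * k) / real (2 * k + 1)"])
  have "AE v in lborel. v \<noteq> 0 \<and> v \<noteq> (1::real)"
    by (intro AE_conjI AE_lborel_singleton)
  then show "AE v in lborel. v \<in> {0..1} \<longrightarrow> (\<lambda>k. 2 * v ^ (2 * k) / real (2 * k + 1)) sums log_kernel v"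
    by eventually_elim (rule impI, rule log_kernel_sums_below_1, auto)
next
  fix k :: nat
  have "((\<lambda>v. 2 * v ^ (2 * k + 1) / real (2 * k + 1) ^ 2) has_real_derivative 2 * v ^ (2 * k) / real (2 * k + 1)) (at v)" for v
    by (rule derivative_eq_intros refl | simp add: power2_eq_square del: of_nat_Suc)+
  then have "(\<integral>\<^sup>+ v. ennreal (2 * v ^ (2 * k) / real (2 * k + 1)) * indicator {0..1} v \<partial>lborel)
    = ennreal (2 * 1 ^ (2 * k + 1) / real (2 * k + 1) ^ 2 - 2 * 0 ^ (2 * k + 1) / real (2 * k + 1) ^ 2)"
    by (intro nn_integral_FTC_Icc) auto
  then show "(\<integral>\<^sup>+ v. ennreal (2 * v ^ (2 * k) / real (2 * k + 1)) * indicator {0..1} v \<partial>lborel)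
    = ennreal (2 / real (2 * k + 1) ^ 2)" by simp
qed auto

lemma nn_integral_log_kernel_above_1:
  "(\<integral>\<^sup>+ v. ennreal (log_kernel v) * indicator {1..} v \<partial>lborel) = ennreal (pi\<^sup>2 / 4)"
proof (rule nn_integral_log_kernel_series[where f = "\<lambda>k v. 2 / (real (2 * k + 1) * v ^ (2 * k + 2))"])
  show "AE v in lborel. v \<in> {1..} \<longrightarrow> (\<lambda>k. 2 / (real (2 * k + 1) * v ^ (2 * k + 2))) sums log_kernel v"
    using AE_lborel_singleton[of 1] by eventually_elim (rule impI, rule log_kernel_sums_above_1, auto)
next
  fix k :: nat
  have deriv: "((\<lambda>v. - 2 / (r\<^sup>2 * v ^ Suc p)) has_real_derivative 2 / (r * v ^ (p + 2))) (at v)"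
    if "1 \<le> v" "r = real (Suc p)" for v r p
  proof -
    have nz: "v \<noteq> 0" "r \<noteq> 0" using that by auto
    have pow: "((\<lambda>v. v ^ Suc p) has_real_derivative r * v ^ p) (at v)"
      using DERIV_pow[of "Suc p" v] that(2) by simp
    show ?thesis
      by (rule DERIV_cong[OF DERIV_divide[OF DERIV_const DERIV_cmult[OF pow]]])
         (use nz in \<open>auto simp: field_simps power2_eq_square\<close>)
  qed
  have "((\<lambda>v. - 2 / (real (2 * k + 1) ^ 2 * v ^ (2 * k + 1))) has_real_derivative
      2 / (real (2 * k + 1) * v ^ (2 * k + 2))) (at v)" if "1 \<le> v" for v
    using deriv[OF that, of "real (2 * k + 1)" "2 * k"] by simp
  moreover have "((\<lambda>v::real. - 2 / (real (2 * k + 1) ^ 2 * v ^ (2 * k + 1))) \<longlongrightarrow> 0) at_top"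
    by (intro tendsto_divide_0[OF tendsto_const] filterlim_at_top_imp_at_infinity
        filterlim_tendsto_pos_mult_at_top[OF tendsto_const] filterlim_pow_at_top filterlim_ident) auto
  ultimately have "(\<integral>\<^sup>+ v. ennreal (2 / (real (2 * k + 1) * v ^ (2 * k + 2))) * indicator {1..} v \<partial>lborel)
    = ennreal (0 - (- 2 / (real (2 * k + 1) ^ 2 * 1 ^ (2 * k + 1))))"
    by (intro nn_integral_FTC_atLeast) auto
  then show "(\<integral>\<^sup>+ v. ennreal (2 / (real (2 * k + 1) * v ^ (2 * k + 2))) * indicator {1..} v \<partial>lborel)
    = ennreal (2 / real (2 * k + 1) ^ 2)" by simp
qed auto

lemma has_bochner_integral_log_kernel: "has_bochner_integral lborel log_kernel (pi\<^sup>2)"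
proof (rule has_bochner_integral_nn_integral)
  have "(\<integral>\<^sup>+ v. ennreal (log_kernel v) * indicator {0<..} v \<partial>lborel)
     = (\<integral>\<^sup>+ v. ennreal (log_kernel v) * indicator {0..1} v + ennreal (log_kernel v) * indicator {1..} v \<partial>lborel)"
    by (intro nn_integral_cong_AE, use AE_lborel_singleton[of "0::real"] AE_lborel_singleton[of "1::real"] in eventually_elim)
       (auto simp: indicator_def)
  also have "\<dots> = ennreal (pi\<^sup>2 / 4) + ennreal (pi\<^sup>2 / 4)"
    by (subst nn_integral_add) (simp_all add: nn_integral_log_kernel_below_1 nn_integral_log_kernel_above_1)
  also have "\<dots> = ennreal (pi\<^sup>2 / 2)" by (simp flip: ennreal_plus)
  finally have "(\<integral>\<^sup>+ v. ennreal (log_kernel v) \<partial>lborel) = 2 * ennreal (pi\<^sup>2 / 2)"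
    by (subst nn_integral_even) (simp_all add: log_kernel_minus)
  also have "\<dots> = ennreal (2 * (pi\<^sup>2 / 2))" by (subst ennreal_mult') simp_all
  finally show "(\<integral>\<^sup>+ v. ennreal (log_kernel v) \<partial>lborel) = ennreal (pi\<^sup>2)" by simp
qed (auto simp: log_kernel_nonneg)

section \<open>Truncated Hilbert transforms of logarithms\<close>

text \<open>The null set on which the bound fails may depend on e: the limit is tested along
  sequences, and then only countably many such sets occur.\<close>

lemma dominated_convergence_at_right:
  fixes f :: "'a \<Rightarrow> real" and s :: "real \<Rightarrow> 'a \<Rightarrow> real"
  assumes "f \<in> borel_measurable M" "\<And>e. 0 < e \<Longrightarrow> s e \<in> borel_measurable M" "integrable M w"
    and lim: "AE x in M. ((\<lambda>e. s e x) \<longlongrightarrow> f x) (at_right 0)"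
    and bound: "\<And>e. 0 < e \<Longrightarrow> AE x in M. \<bar>s e x\<bar> \<le> w x"
  shows "((\<lambda>e. \<integral>x. s e x \<partial>M) \<longlongrightarrow> (\<integral>x. f x \<partial>M)) (at_right 0)"
  unfolding tendsto_at_iff_sequentially
proof (intro allI impI)
  fix X :: "nat \<Rightarrow> real"
  assume X: "\<forall>i. X i \<in> {0<..} - {0}" "X \<longlonglongrightarrow> 0"
  have "(\<lambda>i. \<integral>x. s (X i) x \<partial>M) \<longlonglongrightarrow> (\<integral>x. f x \<partial>M)"
  proof (rule integral_dominated_convergence[where w = w])
    show "AE x in M. (\<lambda>i. s (X i) x) \<longlonglongrightarrow> f x"
      using lim
    proof eventually_elim
      case (elim x)
      then show ?case using X unfolding tendsto_at_iff_sequentially by (auto simp: o_def)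
    qed
  qed (use assms X in auto)
  then show "((\<lambda>e. \<integral>x. s e x \<partial>M) \<circ> X) \<longlonglongrightarrow> (\<integral>x. f x \<partial>M)"
    by (simp add: o_def)
qed

section \<open>The truncated kernel 1/u and its primitive\<close>

definition trunc_inv :: "real \<Rightarrow> real \<Rightarrow> real" where
  "trunc_inv \<epsilon> u = (if \<epsilon> < \<bar>u\<bar> then 1 / u else 0)"

text \<open>A continuous primitive of \<open>trunc_inv \<epsilon>\<close>: the logarithm of |u|,
  frozen at the value ln \<epsilon> where the kernel is cut off.\<close>

definition trunc_ln :: "real \<Rightarrow> real \<Rightarrow> real" where
  "trunc_ln \<epsilon> u = ln (max \<epsilon> \<bar>u\<bar>)"

definition log_ratio :: "real \<Rightarrow> real \<Rightarrow> real \<Rightarrow> real" where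
  "log_ratio a b t = ln (\<bar>t - a\<bar>) - ln (\<bar>t - b\<bar>)"

definition trunc_log_ratio :: "real \<Rightarrow> real \<Rightarrow> real \<Rightarrow> real \<Rightarrow> real" where
  "trunc_log_ratio \<epsilon> a b t = trunc_ln \<epsilon> (t - a) - trunc_ln \<epsilon> (t - b)"

lemma trunc_inv_borel [measurable]: "trunc_inv \<epsilon> \<in> borel_measurable borel"
  unfolding trunc_inv_def by measurable

lemma trunc_ln_borel [measurable]: "trunc_ln \<epsilon> \<in> borel_measurable borel"
  unfolding trunc_ln_def by measurable

lemma log_ratio_borel [measurable]: "log_ratio a b \<in> borel_measurable borel"
  unfolding log_ratio_def by measurable

lemma trunc_log_ratio_borel [measurable]: "trunc_log_ratio \<epsilon> a b \<in> borel_measurable borel"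
  unfolding trunc_log_ratio_def by measurable

lemma trunc_inv_minus: "trunc_inv \<epsilon> (- u) = - trunc_inv \<epsilon> u"
  by (simp add: trunc_inv_def)

lemma trunc_inv_bound: "0 < \<epsilon> \<Longrightarrow> \<bar>trunc_inv \<epsilon> u\<bar> \<le> 1 / \<epsilon>"
  by (auto simp: trunc_inv_def abs_divide intro!: divide_left_mono mult_pos_pos)

lemma continuous_on_trunc_ln: "0 < \<epsilon> \<Longrightarrow> continuous_on A (trunc_ln \<epsilon>)"
  unfolding trunc_ln_def by (intro continuous_intros) auto

lemma trunc_ln_has_derivative:
  assumes "0 < \<epsilon>" "\<bar>u\<bar> \<noteq> \<epsilon>"
  shows "(trunc_ln \<epsilon> has_real_derivative trunc_inv \<epsilon> u) (at u)"
proof -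
  consider "u > \<epsilon>" | "u < - \<epsilon>" | "\<bar>u\<bar> < \<epsilon>" using assms by linarith
  then show ?thesis
  proof cases
    case 1
    have "(ln has_real_derivative trunc_inv \<epsilon> u) (at u)"
      using 1 assms by (auto intro!: derivative_eq_intros simp: trunc_inv_def)
    then show ?thesis
      by (rule has_field_derivative_transform_within_open[where S = "{\<epsilon><..}"])
         (use 1 assms in \<open>auto simp: trunc_ln_def max_def\<close>)
  next
    case 2
    have "((\<lambda>v. ln (- v)) has_real_derivative trunc_inv \<epsilon> u) (at u)"
      using 2 assms by (auto intro!: derivative_eq_intros simp: trunc_inv_def)
    then show ?thesis
      by (rule has_field_derivative_transform_within_open[where S = "{..<-\<epsilon>}"])
         (use 2 assms in \<open>auto simp: trunc_ln_def max_def\<close>)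
  next
    case 3
    have "((\<lambda>v. ln \<epsilon>) has_real_derivative trunc_inv \<epsilon> u) (at u)"
      using 3 assms by (auto simp: trunc_inv_def)
    then show ?thesis
      by (rule has_field_derivative_transform_within_open[where S = "{-\<epsilon><..<\<epsilon>}"])
         (use 3 assms in \<open>auto simp: trunc_ln_def max_def\<close>)
  qed
qed

lemma integral_trunc_inv:
  assumes "0 < \<epsilon>" "a \<le> b"
  shows "has_bochner_integral lborel (\<lambda>t. indicator {a..b} t * trunc_inv \<epsilon> (x - t)) (trunc_log_ratio \<epsilon> a b x)"
proof -
  have "((\<lambda>t. trunc_inv \<epsilon> (x - t)) has_integral (- trunc_ln \<epsilon> (x - b) - (- trunc_ln \<epsilon> (x - a)))) {a..b}"
  \<comment> \<open>The primitive is continuous but has kinks at the two cut-off points, which form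
    the exceptional set S.\<close>
  proof (rule fundamental_theorem_of_calculus_interior_strong[where S = "{x - \<epsilon>, x + \<epsilon>}"])
    fix t assume t: "t \<in> {a<..<b} - {x - \<epsilon>, x + \<epsilon>}"
    have "((\<lambda>t. trunc_ln \<epsilon> (x - t)) has_real_derivative trunc_inv \<epsilon> (x - t) * (- 1)) (at t)"
      using t assms(1)
      by (intro DERIV_chain'[of "\<lambda>t. x - t" "-1" t UNIV "trunc_ln \<epsilon>"] trunc_ln_has_derivative)
         (auto intro!: derivative_eq_intros simp: abs_if split: if_splits)
    from DERIV_minus[OF this]
    show "((\<lambda>t. - trunc_ln \<epsilon> (x - t)) has_vector_derivative trunc_inv \<epsilon> (x - t)) (at t)"
      by (simp add: has_real_derivative_iff_has_vector_derivative)
  next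
    show "continuous_on {a..b} (\<lambda>t. - trunc_ln \<epsilon> (x - t))"
      by (intro continuous_intros continuous_on_compose2[OF continuous_on_trunc_ln[OF assms(1), of UNIV]]) auto
  qed (use assms in auto)
  then have int: "integral {a..b} (\<lambda>t. trunc_inv \<epsilon> (x - t)) = trunc_log_ratio \<epsilon> a b x"
    by (simp add: integral_unique trunc_log_ratio_def)
  have "set_integrable lborel {a..b} (\<lambda>t. trunc_inv \<epsilon> (x - t))"
    unfolding set_integrable_def
    by (intro integrableI_bounded_set_indicator[where B = "1 / \<epsilon>"])
       (use trunc_inv_bound[OF assms(1)] assms in \<open>auto simp: emeasure_lborel_Icc\<close>)
  with int set_borel_integral_eq_integral[OF this] show ?thesis
    by (simp add: has_bochner_integral_iff set_integrable_def set_lebesgue_integral_def)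
qed

text \<open>Truncation replaces both logarithms by their maximum with ln \<epsilon>, and this
  clamping is monotone and 1-Lipschitz. The Lipschitz part supplies the dominating function in
  \<open>log_ratio_inner\<close>, the monotone part the nonnegativity for Fatou's lemma in
  \<open>integrable_log_ratio_square\<close>.\<close>

lemma trunc_log_ratio_abs_le:
  assumes "0 < \<epsilon>" "t \<noteq> a" "t \<noteq> b"
  shows "\<bar>trunc_log_ratio \<epsilon> a b t\<bar> \<le> \<bar>log_ratio a b t\<bar>"
    and "0 \<le> log_ratio a b t * trunc_log_ratio \<epsilon> a b t"
proof -
  have clip: "trunc_log_ratio \<epsilon> a b t = max (ln \<epsilon>) (ln (\<bar>t - a\<bar>)) - max (ln \<epsilon>) (ln (\<bar>t - b\<bar>))"
  proof -
    have "trunc_ln \<epsilon> u = max (ln \<epsilon>) (ln (\<bar>u\<bar>))" if "u \<noteq> 0" for u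
      using assms(1) that by (cases "\<epsilon> \<le> \<bar>u\<bar>") (auto simp: trunc_ln_def max_def)
    then show ?thesis using assms by (simp add: trunc_log_ratio_def)
  qed
  show "\<bar>trunc_log_ratio \<epsilon> a b t\<bar> \<le> \<bar>log_ratio a b t\<bar>"
  proof -
    have "\<bar>max c x - max c y\<bar> \<le> \<bar>x - y\<bar>" for c x y :: real by arith
    then show ?thesis unfolding clip log_ratio_def .
  qed
  show "0 \<le> log_ratio a b t * trunc_log_ratio \<epsilon> a b t"
  proof -
    have "0 \<le> (x - y) * (max c x - max c y)" for c x y :: real
    proof (cases "x \<le> y")
      case True
      then show ?thesis by (intro mult_nonpos_nonpos) linarith+
    next
      case False
      then show ?thesis by (intro mult_nonneg_nonneg) linarith+
    qed
    then show ?thesis unfolding clip log_ratio_def .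
  qed
qed

lemma trunc_log_ratio_tendsto:
  assumes "t \<noteq> a" "t \<noteq> b"
  shows "((\<lambda>\<epsilon>. trunc_log_ratio \<epsilon> a b t) \<longlongrightarrow> log_ratio a b t) (at_right 0)"
proof -
  have "\<forall>\<^sub>F \<epsilon> in at_right 0. \<epsilon> < min \<bar>t - a\<bar> \<bar>t - b\<bar>"
    using assms by (intro eventually_at_right_less[of 0] eventually_at_rightI[of 0 "min \<bar>t - a\<bar> \<bar>t - b\<bar>"]) auto
  then have "\<forall>\<^sub>F \<epsilon> in at_right 0. trunc_log_ratio \<epsilon> a b t = log_ratio a b t"
    by eventually_elim (simp add: trunc_log_ratio_def trunc_ln_def log_ratio_def max_def)
  then show ?thesis by (rule tendsto_eventually)
qed

text \<open>The affine map with centre m and scale r carries {a..b} to {-1..1}. A logarithmic ratio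
  decays only like 1/t and is not integrable; the factorization isolates an integrable
  factor.\<close>

lemma log_ratio_eq_log_kernel:
  assumes "a < b" "t \<noteq> a" "t \<noteq> b"
  defines "m \<equiv> (a + b) / 2" and "r \<equiv> (b - a) / 2"
  shows "log_ratio a b t = log_kernel ((t - m) / r) * ((t - m) / r)"
proof (cases "t = m")
  case True
  then have "t - b = - (t - a)" by (simp add: m_def field_simps)
  then have "log_ratio a b t = 0" unfolding log_ratio_def by (metis abs_minus_cancel diff_self)
  then show ?thesis using True by simp
next
  case False
  have r: "r > 0" using assms by simp
  have "t - a = r * (1 + (t - m) / r)" "b - t = r * (1 - (t - m) / r)"
    using r by (auto simp: m_def r_def divide_simps) (auto simp: field_simps)?
  then have "\<bar>t - a\<bar> = r * \<bar>1 + (t - m) / r\<bar>" "\<bar>t - b\<bar> = r * \<bar>1 - (t - m) / r\<bar>"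
    using r by (metis abs_mult abs_of_pos, metis abs_minus_commute abs_mult abs_of_pos)
  moreover have "\<bar>1 + (t - m) / r\<bar> > 0" "\<bar>1 - (t - m) / r\<bar> > 0"
    using calculation assms(2,3) by auto
  ultimately have "log_ratio a b t = ln (\<bar>1 + (t - m) / r\<bar>) - ln (\<bar>1 - (t - m) / r\<bar>)"
    using r by (simp add: log_ratio_def ln_mult)
  then show ?thesis
    using r False by (simp add: log_kernel_def)
qed

lemma integrable_log_kernel_affine:
  "r \<noteq> 0 \<Longrightarrow> integrable lborel (\<lambda>t. log_kernel ((t - m) / r))"
proof -
  assume r: "r \<noteq> 0"
  have "integrable lborel (\<lambda>t. log_kernel (- m / r + (1 / r) * t))"
    using has_bochner_integral_log_kernel r
    by (intro lborel_integrable_real_affine) (auto simp: has_bochner_integral_iff)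
  then show ?thesis by (simp add: diff_divide_distrib)
qed

text \<open>The growing factor |t - m| is absorbed by the truncated kernel: |t - m| is at most |x -
  t| + |x - m|, the product of |x - t| with the kernel is at most 1, and the kernel itself is at
  most 1/\<epsilon>.\<close>

lemma log_ratio_trunc_inv_bound:
  assumes "a < b" "0 < \<epsilon>" "t \<noteq> a" "t \<noteq> b"
  defines "m \<equiv> (a + b) / 2" and "r \<equiv> (b - a) / 2"
  shows "\<bar>log_ratio a b t * trunc_inv \<epsilon> (x - t)\<bar> \<le> (1 + \<bar>x - m\<bar> / \<epsilon>) / r * log_kernel ((t - m) / r)"
proof -
  have r: "r > 0" using assms by simp
  have "\<bar>t - m\<bar> * \<bar>trunc_inv \<epsilon> (x - t)\<bar> \<le> 1 + \<bar>x - m\<bar> / \<epsilon>"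
  proof -
    have "\<bar>t - m\<bar> * \<bar>trunc_inv \<epsilon> (x - t)\<bar> \<le> (\<bar>x - t\<bar> + \<bar>x - m\<bar>) * \<bar>trunc_inv \<epsilon> (x - t)\<bar>"
      by (intro mult_right_mono) auto
    also have "\<dots> = \<bar>x - t\<bar> * \<bar>trunc_inv \<epsilon> (x - t)\<bar> + \<bar>x - m\<bar> * \<bar>trunc_inv \<epsilon> (x - t)\<bar>"
      by (simp add: algebra_simps)
    also have "\<dots> \<le> 1 + \<bar>x - m\<bar> * (1 / \<epsilon>)"
      by (intro add_mono mult_left_mono trunc_inv_bound assms) (auto simp: trunc_inv_def abs_divide)
    finally show ?thesis by simp
  qed
  then have "log_kernel ((t - m) / r) / r * (\<bar>t - m\<bar> * \<bar>trunc_inv \<epsilon> (x - t)\<bar>)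
      \<le> log_kernel ((t - m) / r) / r * (1 + \<bar>x - m\<bar> / \<epsilon>)"
    using r log_kernel_nonneg by (intro mult_left_mono) auto
  moreover have "\<bar>log_ratio a b t\<bar> = log_kernel ((t - m) / r) * (\<bar>t - m\<bar> / r)"
  proof -
    have "log_ratio a b t = log_kernel ((t - m) / r) * ((t - m) / r)"
      unfolding m_def r_def by (rule log_ratio_eq_log_kernel[OF assms(1,3,4)])
    then show ?thesis using r log_kernel_nonneg by (simp add: abs_mult)
  qed
  ultimately show ?thesis using r by (simp add: abs_mult mult_ac)
qed

lemma AE_lborel_not_in_finite: "finite A \<Longrightarrow> AE t in lborel. t \<notin> (A :: real set)"
  by (intro AE_not_in countable_imp_null_set_lborel countable_finite)

lemma AE_lborel_not_pair: "AE t in lborel. t \<notin> {a, b :: real}"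
  by (rule AE_lborel_not_in_finite) simp

lemma integrable_log_ratio_trunc_inv:
  assumes "a < b" "0 < \<epsilon>"
  shows "integrable lborel (\<lambda>t. log_ratio a b t * trunc_inv \<epsilon> (x - t))"
proof (rule Bochner_Integration.integrable_bound)
  show "integrable lborel (\<lambda>t. (1 + \<bar>x - (a + b) / 2\<bar> / \<epsilon>) / ((b - a) / 2) * log_kernel ((t - (a + b) / 2) / ((b - a) / 2)))"
    using assms by (intro integrable_mult_right integrable_log_kernel_affine) auto
  show "AE t in lborel. norm (log_ratio a b t * trunc_inv \<epsilon> (x - t))
     \<le> norm ((1 + \<bar>x - (a + b) / 2\<bar> / \<epsilon>) / ((b - a) / 2) * log_kernel ((t - (a + b) / 2) / ((b - a) / 2)))"
    using AE_lborel_not_pair[of "a" "b"]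
  proof eventually_elim
    case (elim t)
    then show ?case unfolding real_norm_def
      by (intro order_trans[OF log_ratio_trunc_inv_bound[OF assms] abs_ge_self]) auto
  qed
qed measurable

section \<open>The Hilbert transform of a logarithmic ratio\<close>

definition shifted_kernel :: "real \<Rightarrow> real \<Rightarrow> real" where
  "shifted_kernel p u = (ln (\<bar>p + u\<bar>) - ln (\<bar>p - u\<bar>)) / u"

lemma shifted_kernel_borel [measurable]: "shifted_kernel p \<in> borel_measurable borel"
  unfolding shifted_kernel_def by measurable

lemma shifted_kernel_eq:
  assumes "p \<noteq> 0" "u \<noteq> p" "u \<noteq> - p"
  shows "shifted_kernel p u = log_kernel (u / p) / p"
proof (cases "u = 0")
  case False
  have "\<bar>p + u\<bar> = \<bar>p\<bar> * \<bar>1 + u / p\<bar>" "\<bar>p - u\<bar> = \<bar>p\<bar> * \<bar>1 - u / p\<bar>"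
    using assms by (simp_all flip: abs_mult add: algebra_simps)
  moreover have "\<bar>1 + u / p\<bar> > 0" "\<bar>1 - u / p\<bar> > 0"
    using calculation assms by auto
  ultimately show ?thesis
    using assms False by (simp add: shifted_kernel_def log_kernel_def ln_mult)
qed (simp add: shifted_kernel_def log_kernel_def)

text \<open>The substitution u = p v reduces the kernel to \<open>log_kernel\<close>, and |p|
  cancels against the Jacobian. Only the sign of p survives; with p = x - a and p = x - b these
  signs later recombine to the indicator of {a..b}.\<close>

lemma shifted_kernel_integral:
  shows "integrable lborel (shifted_kernel p)"
    and "(\<integral>u. shifted_kernel p u \<partial>lborel) = sgn p * pi\<^sup>2"
    and "(\<integral>u. \<bar>shifted_kernel p u\<bar> \<partial>lborel) \<le> pi\<^sup>2"
proof -
  have "integrable lborel (shifted_kernel p) \<and> (\<integral>u. shifted_kernel p u \<partial>lborel) = sgn p * pi\<^sup>2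
      \<and> (\<integral>u. \<bar>shifted_kernel p u\<bar> \<partial>lborel) \<le> pi\<^sup>2"
  proof (cases "p = 0")
    case True
    then have "shifted_kernel p = (\<lambda>u. 0)" by (auto simp: shifted_kernel_def)
    then show ?thesis using True by simp
  next
    case False
    have eq: "AE u in lborel. shifted_kernel p u = log_kernel (u / p) / p"
      using AE_lborel_not_pair[of "p" "-p"] by eventually_elim (use False shifted_kernel_eq in auto)
    have int: "integrable lborel (\<lambda>u. log_kernel (u / p))"
      using integrable_log_kernel_affine[OF False, of 0] by simp
    have "pi\<^sup>2 = \<bar>1 / p\<bar> *\<^sub>R (\<integral>u. log_kernel (0 + (1 / p) * u) \<partial>lborel)"
      using has_bochner_integral_log_kernel False
      by (subst lborel_integral_real_affine[symmetric]) (auto simp: has_bochner_integral_iff)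
    then have val: "(\<integral>u. log_kernel (u / p) \<partial>lborel) = \<bar>p\<bar> * pi\<^sup>2"
      using False by (simp add: field_simps)
    have "integrable lborel (shifted_kernel p)"
      using eq int by (subst integrable_cong_AE[OF _ _ eq]) auto
    moreover have "(\<integral>u. shifted_kernel p u \<partial>lborel) = sgn p * pi\<^sup>2"
      using val False by (subst integral_cong_AE[OF _ _ eq]) (auto simp: sgn_if)
    moreover have "(\<integral>u. \<bar>shifted_kernel p u\<bar> \<partial>lborel) = (\<integral>u. log_kernel (u / p) / \<bar>p\<bar> \<partial>lborel)"
      by (intro integral_cong_AE, measurable, use eq in eventually_elim)
         (simp add: abs_divide log_kernel_nonneg)
    ultimately show ?thesis using val False by simp
  qed
  then show "integrable lborel (shifted_kernel p)"
    and "(\<integral>u. shifted_kernel p u \<partial>lborel) = sgn p * pi\<^sup>2"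
    and "(\<integral>u. \<bar>shifted_kernel p u\<bar> \<partial>lborel) \<le> pi\<^sup>2" by auto
qed

definition trunc_kernel_integral :: "real \<Rightarrow> real \<Rightarrow> real" where
  "trunc_kernel_integral \<epsilon> p = (\<integral>u. shifted_kernel p u * indicator {u. \<epsilon> < \<bar>u\<bar>} u \<partial>lborel)"

lemma trunc_set_borel [measurable]: "{u::real. \<epsilon> < \<bar>u\<bar>} \<in> sets borel"
  by measurable

lemma integrable_trunc_kernel: "integrable lborel (\<lambda>u. shifted_kernel p u * indicator {u. \<epsilon> < \<bar>u\<bar>} u)"
  by (rule Bochner_Integration.integrable_bound[OF shifted_kernel_integral(1)[of p]])
     (measurable, auto simp: indicator_def)

lemma trunc_kernel_integral_bound: "\<bar>trunc_kernel_integral \<epsilon> p\<bar> \<le> pi\<^sup>2"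
proof -
  have "\<bar>trunc_kernel_integral \<epsilon> p\<bar> \<le> (\<integral>u. \<bar>shifted_kernel p u * indicator {u. \<epsilon> < \<bar>u\<bar>} u\<bar> \<partial>lborel)"
    unfolding trunc_kernel_integral_def by (rule integral_abs_bound)
  also have "\<dots> \<le> (\<integral>u. \<bar>shifted_kernel p u\<bar> \<partial>lborel)"
    by (intro integral_mono integrable_abs integrable_trunc_kernel shifted_kernel_integral)
       (auto simp: indicator_def)
  also have "\<dots> \<le> pi\<^sup>2" by (rule shifted_kernel_integral)
  finally show ?thesis .
qed

lemma trunc_kernel_integral_tendsto:
  "((\<lambda>\<epsilon>. trunc_kernel_integral \<epsilon> p) \<longlongrightarrow> sgn p * pi\<^sup>2) (at_right 0)"
  unfolding trunc_kernel_integral_def shifted_kernel_integral(2)[symmetric]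
proof (rule dominated_convergence_at_right[where w = "\<lambda>u. \<bar>shifted_kernel p u\<bar>"])
  show "AE u in lborel. ((\<lambda>e. shifted_kernel p u * indicator {u. e < \<bar>u\<bar>} u) \<longlongrightarrow> shifted_kernel p u) (at_right 0)"
    using AE_lborel_singleton[of "0::real"]
  proof eventually_elim
    case (elim u)
    have "\<forall>\<^sub>F \<epsilon> in at_right 0. \<epsilon> < \<bar>u\<bar>"
      using elim by (intro eventually_at_rightI[of 0 "\<bar>u\<bar>"]) auto
    then have "\<forall>\<^sub>F \<epsilon> in at_right 0. shifted_kernel p u * indicator {u. \<epsilon> < \<bar>u\<bar>} u = shifted_kernel p u"
      by eventually_elim simp
    then show ?case by (rule tendsto_eventually)
  qed
qed (auto simp: indicator_def intro!: shifted_kernel_integral)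

text \<open>Averaging the substitutions t = x - u and t = x + u turns the truncated Hilbert transform
  of a logarithm into an integral of an absolutely integrable kernel.\<close>
lemma integral_log_ratio_trunc_inv:
  assumes "a < b" "0 < \<epsilon>"
  shows "(\<integral>t. log_ratio a b t * trunc_inv \<epsilon> (x - t) \<partial>lborel)
    = - (trunc_kernel_integral \<epsilon> (x - a) - trunc_kernel_integral \<epsilon> (x - b)) / 2"
proof -
  define h where "h u = log_ratio a b (x - u) * trunc_inv \<epsilon> u" for u
  have [measurable]: "h \<in> borel_measurable borel" unfolding h_def by measurable
  let ?g = "\<lambda>t. log_ratio a b t * trunc_inv \<epsilon> (x - t)"
  have inth: "integrable lborel h"
    using lborel_integrable_real_affine[OF integrable_log_ratio_trunc_inv[OF assms, of x], of "-1" x]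
    by (simp add: h_def[abs_def])
  have inth': "integrable lborel (\<lambda>u. h (- u))"
    using lborel_integrable_real_affine[OF inth, of "-1" 0] by simp
  have "(\<integral>t. ?g t \<partial>lborel) = (\<integral>u. h u \<partial>lborel)"
    by (subst lborel_integral_real_affine[of "-1" _ x]) (simp_all add: h_def)
  moreover have "(\<integral>u. h u \<partial>lborel) = (\<integral>u. h (- u) \<partial>lborel)"
    by (subst lborel_integral_real_affine[of "-1" _ 0]) simp_all
  ultimately have sum: "(\<integral>t. ?g t \<partial>lborel) = (\<integral>u. h u + h (- u) \<partial>lborel) / 2"
    using inth inth' by simp
  have "h u + h (- u) = - (shifted_kernel (x - a) u * indicator {u. \<epsilon> < \<bar>u\<bar>} u
      - shifted_kernel (x - b) u * indicator {u. \<epsilon> < \<bar>u\<bar>} u)" for u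
  proof -
    have "\<bar>x - u - a\<bar> = \<bar>x - a - u\<bar>" "\<bar>x - u - b\<bar> = \<bar>x - b - u\<bar>"
       "\<bar>x + u - a\<bar> = \<bar>x - a + u\<bar>" "\<bar>x + u - b\<bar> = \<bar>x - b + u\<bar>" by auto
    then show ?thesis
      by (simp add: h_def trunc_inv_minus log_ratio_def shifted_kernel_def trunc_inv_def indicator_def
          diff_divide_distrib)
  qed
  then show ?thesis
    unfolding sum by (simp add: trunc_kernel_integral_def integrable_trunc_kernel)
qed

text \<open>Uniformity in x and \<epsilon> is the point: pi^2 becomes the dominating constant on
  {c..d} in \<open>log_ratio_duality_tendsto\<close>.\<close>

lemma integral_log_ratio_trunc_inv_bound:
  assumes "a < b" "0 < \<epsilon>"
  shows "\<bar>\<integral>t. log_ratio a b t * trunc_inv \<epsilon> (x - t) \<partial>lborel\<bar> \<le> pi\<^sup>2"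
  using trunc_kernel_integral_bound[of \<epsilon> "x - a"] trunc_kernel_integral_bound[of \<epsilon> "x - b"]
  by (simp add: integral_log_ratio_trunc_inv[OF assms])

text \<open>Off the endpoints, half the difference of the signs of x - a and x - b is the indicator
  of {a..b}. With one factor 1/pi from each of the two transforms, this says that H applied twice to
  that indicator is its negative.\<close>

lemma integral_log_ratio_trunc_inv_tendsto:
  assumes "a < b" "x \<noteq> a" "x \<noteq> b"
  shows "((\<lambda>\<epsilon>. \<integral>t. log_ratio a b t * trunc_inv \<epsilon> (x - t) \<partial>lborel)
    \<longlongrightarrow> - pi\<^sup>2 * indicator {a..b} x) (at_right 0)"
proof -
  have "((\<lambda>\<epsilon>. - (trunc_kernel_integral \<epsilon> (x - a) - trunc_kernel_integral \<epsilon> (x - b)) / 2)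
      \<longlongrightarrow> - (sgn (x - a) * pi\<^sup>2 - sgn (x - b) * pi\<^sup>2) / 2) (at_right 0)"
    by (intro tendsto_intros trunc_kernel_integral_tendsto) auto
  moreover have "- (sgn (x - a) * pi\<^sup>2 - sgn (x - b) * pi\<^sup>2) / 2 = - pi\<^sup>2 * indicator {a..b} x"
    using assms by (auto simp: sgn_if indicator_def)
  moreover have "\<forall>\<^sub>F \<epsilon> in at_right 0. - (trunc_kernel_integral \<epsilon> (x - a) - trunc_kernel_integral \<epsilon> (x - b)) / 2
      = (\<integral>t. log_ratio a b t * trunc_inv \<epsilon> (x - t) \<partial>lborel)"
    by (rule eventually_at_rightI[of 0 1]) (use assms in \<open>auto simp: integral_log_ratio_trunc_inv\<close>)
  ultimately show ?thesis by (simp add: tendsto_cong)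
qed

section \<open>Inner products of logarithmic ratios\<close>

lemma integral_trunc_inv_fst:
  assumes "0 < \<epsilon>" "c \<le> d"
  shows "has_bochner_integral lborel (\<lambda>x. indicator {c..d} x * trunc_inv \<epsilon> (x - t)) (- trunc_log_ratio \<epsilon> c d t)"
proof -
  have "trunc_inv \<epsilon> (x - t) = - trunc_inv \<epsilon> (t - x)" for x
    by (simp flip: trunc_inv_minus)
  then show ?thesis
    using has_bochner_integral_minus[OF integral_trunc_inv[OF assms, of t]] by simp
qed

lemma integrable_pair_log_ratio_trunc_inv:
  assumes "a < b" "c < d" "0 < \<epsilon>"
  shows "integrable (lborel \<Otimes>\<^sub>M lborel)
    (\<lambda>(x, t). indicator {c..d} x * (log_ratio a b t * trunc_inv \<epsilon> (x - t)))"
proof (rule lborel_pair.Fubini_integrable)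
  define m r where "m = (a + b) / 2" and "r = (b - a) / 2"
  have r: "r > 0" using assms by (simp add: r_def)
  \<comment> \<open>For x in {c..d}, |x - m| is at most |c| + |d| + |m|, so C makes
    \<open>log_ratio_trunc_inv_bound\<close> uniform in x.\<close>
  define C where "C = (1 + (\<bar>c\<bar> + \<bar>d\<bar> + \<bar>m\<bar>) / \<epsilon>) / r"
  define K where "K = (\<integral>t. log_kernel ((t - m) / r) \<partial>lborel)"
  let ?f = "\<lambda>(x, t). indicator {c..d} x * (log_ratio a b t * trunc_inv \<epsilon> (x - t))"
  show meas [measurable]: "?f \<in> borel_measurable (lborel \<Otimes>\<^sub>M lborel)" by measurable
  show "AE x in lborel. integrable lborel (\<lambda>t. ?f (x, t))"
    using integrable_log_ratio_trunc_inv[OF assms(1,3)] by (intro AE_I2) simp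
  have "C \<ge> 0" using r assms by (auto simp: C_def)
  have bound: "(\<integral>t. norm (?f (x, t)) \<partial>lborel) \<le> indicator {c..d} x * (C * K)" for x
  proof (cases "x \<in> {c..d}")
    case True
    have "(\<integral>t. norm (?f (x, t)) \<partial>lborel) \<le> (\<integral>t. C * log_kernel ((t - m) / r) \<partial>lborel)"
    proof (rule integral_mono_AE)
      show "integrable lborel (\<lambda>t. norm (?f (x, t)))"
        using integrable_log_ratio_trunc_inv[OF assms(1,3), of x] by (intro integrable_norm) simp
      show "integrable lborel (\<lambda>t. C * log_kernel ((t - m) / r))"
        using r by (intro integrable_mult_right integrable_log_kernel_affine) simp
      show "AE t in lborel. norm (?f (x, t)) \<le> C * log_kernel ((t - m) / r)"
        using AE_lborel_not_pair[of a b]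
      proof eventually_elim
        case (elim t)
        have "\<bar>log_ratio a b t * trunc_inv \<epsilon> (x - t)\<bar> \<le> (1 + \<bar>x - m\<bar> / \<epsilon>) / r * log_kernel ((t - m) / r)"
          unfolding m_def r_def using elim by (intro log_ratio_trunc_inv_bound assms) auto
        also have "\<dots> \<le> C * log_kernel ((t - m) / r)"
          unfolding C_def using True r assms log_kernel_nonneg
          by (intro mult_right_mono divide_right_mono add_left_mono) auto
        finally show ?case using True by simp
      qed
    qed
    then show ?thesis using True by (simp add: K_def)
  qed simp
  show "integrable lborel (\<lambda>x. \<integral>t. norm (?f (x, t)) \<partial>lborel)"
  proof (rule Bochner_Integration.integrable_bound)
    show "integrable lborel (\<lambda>x. indicator {c..d} x * (C * K))"
      by (intro integrable_mult_left integrable_real_indicator) (auto simp: emeasure_lborel_Icc_eq)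
    show "AE x in lborel. norm (\<integral>t. norm (?f (x, t)) \<partial>lborel) \<le> norm (indicator {c..d} x * (C * K))"
    proof (intro AE_I2)
      fix x
      have "0 \<le> (\<integral>t. norm (?f (x, t)) \<partial>lborel)" by (intro integral_nonneg_AE) simp
      then show "norm (\<integral>t. norm (?f (x, t)) \<partial>lborel) \<le> norm (indicator {c..d} x * (C * K))"
        using bound[of x] by (simp only: real_norm_def)
    qed
  qed measurable
qed

text \<open>Skew-adjointness of the truncated transform. Integrating over x first, the oddness of
  the kernel yields minus \<open>trunc_log_ratio\<close>; integrating over t first yields the inner
  integral whose limit is known.\<close>

lemma log_ratio_duality:
  assumes "a < b" "c < d" "0 < \<epsilon>"
  shows "has_bochner_integral lborel (\<lambda>t. log_ratio a b t * trunc_log_ratio \<epsilon> c d t)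
    (- (\<integral>x. indicator {c..d} x * (\<integral>t. log_ratio a b t * trunc_inv \<epsilon> (x - t) \<partial>lborel) \<partial>lborel))"
proof -
  let ?f = "\<lambda>x t. indicator {c..d} x * (log_ratio a b t * trunc_inv \<epsilon> (x - t))"
  note int = integrable_pair_log_ratio_trunc_inv[OF assms]
  have inner: "(\<integral>x. ?f x t \<partial>lborel) = - (log_ratio a b t * trunc_log_ratio \<epsilon> c d t)" for t
  proof -
    have "(\<integral>x. ?f x t \<partial>lborel) = (\<integral>x. log_ratio a b t * (indicator {c..d} x * trunc_inv \<epsilon> (x - t)) \<partial>lborel)"
      by (simp add: mult_ac)
    also have "\<dots> = log_ratio a b t * (- trunc_log_ratio \<epsilon> c d t)"
      using integral_trunc_inv_fst[of \<epsilon> c d t] assms by (simp add: has_bochner_integral_iff)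
    finally show ?thesis by simp
  qed
  have "integrable lborel (\<lambda>t. \<integral>x. ?f x t \<partial>lborel)"
    using lborel_pair.integrable_snd[OF int] by simp
  moreover have "(\<integral>t. (\<integral>x. ?f x t \<partial>lborel) \<partial>lborel) = (\<integral>x. (\<integral>t. ?f x t \<partial>lborel) \<partial>lborel)"
    by (rule lborel_pair.Fubini_integral[OF int])
  ultimately show ?thesis
    by (simp add: inner has_bochner_integral_iff)
qed

lemma log_ratio_duality_tendsto:
  assumes "a < b" "c < d"
  shows "((\<lambda>\<epsilon>. \<integral>t. log_ratio a b t * trunc_log_ratio \<epsilon> c d t \<partial>lborel)
     \<longlongrightarrow> pi\<^sup>2 * (\<integral>x. indicator {a..b} x * indicator {c..d} x \<partial>lborel)) (at_right 0)"
proof -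
  have "((\<lambda>\<epsilon>. \<integral>x. indicator {c..d} x * (\<integral>t. log_ratio a b t * trunc_inv \<epsilon> (x - t) \<partial>lborel) \<partial>lborel)
     \<longlongrightarrow> (\<integral>x. indicator {c..d} x * (- pi\<^sup>2 * indicator {a..b} x) \<partial>lborel)) (at_right 0)"
  proof (rule dominated_convergence_at_right[where w = "\<lambda>x. indicator {c..d} x * pi\<^sup>2"])
    show "integrable lborel (\<lambda>x. indicator {c..d} x * pi\<^sup>2)"
      by (intro integrable_mult_left integrable_real_indicator) (auto simp: emeasure_lborel_Icc_eq)
    show "AE x in lborel. ((\<lambda>e. indicator {c..d} x * (\<integral>t. log_ratio a b t * trunc_inv e (x - t) \<partial>lborel))
       \<longlongrightarrow> indicator {c..d} x * (- pi\<^sup>2 * indicator {a..b} x)) (at_right 0)"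
      using AE_lborel_not_pair[of a b]
    proof eventually_elim
      case (elim x)
      then show ?case
        by (intro tendsto_mult tendsto_const integral_log_ratio_trunc_inv_tendsto assms) auto
    qed
    show "AE x in lborel. \<bar>indicator {c..d} x * (\<integral>t. log_ratio a b t * trunc_inv e (x - t) \<partial>lborel)\<bar>
        \<le> indicator {c..d} x * pi\<^sup>2" if "0 < e" for e
      using integral_log_ratio_trunc_inv_bound[OF assms(1) that] by (auto simp: indicator_def)
  qed measurable
  then have "((\<lambda>\<epsilon>. - (\<integral>x. indicator {c..d} x * (\<integral>t. log_ratio a b t * trunc_inv \<epsilon> (x - t) \<partial>lborel) \<partial>lborel))
     \<longlongrightarrow> - (\<integral>x. indicator {c..d} x * (- pi\<^sup>2 * indicator {a..b} x) \<partial>lborel)) (at_right 0)"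
    by (rule tendsto_minus)
  moreover have "(\<integral>x. indicator {c..d} x * (- pi\<^sup>2 * indicator {a..b} x) \<partial>lborel)
      = - pi\<^sup>2 * (\<integral>x. indicator {a..b} x * indicator {c..d} x \<partial>lborel)"
    by (subst integral_mult_right_zero[symmetric]) (intro Bochner_Integration.integral_cong, auto simp: indicator_def)
  moreover have "\<forall>\<^sub>F \<epsilon> in at_right 0.
      - (\<integral>x. indicator {c..d} x * (\<integral>t. log_ratio a b t * trunc_inv \<epsilon> (x - t) \<partial>lborel) \<partial>lborel)
      = (\<integral>t. log_ratio a b t * trunc_log_ratio \<epsilon> c d t \<partial>lborel)"
    by (rule eventually_at_rightI[of 0 1])
       (use log_ratio_duality[OF assms] in \<open>auto simp: has_bochner_integral_iff\<close>)
  ultimately show ?thesis by (simp add: tendsto_cong)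
qed

text \<open>The duality with {c..d} equal to {a..b} has nonnegative integrands that tend to the
  square, and their integrals converge. Fatou's lemma then bounds the integral of the square, with
  no estimate near the logarithmic singularities.\<close>

lemma integrable_log_ratio_square:
  assumes "a < b"
  shows "integrable lborel (\<lambda>t. log_ratio a b t * log_ratio a b t)"
proof -
  let ?p = "\<lambda>i t. log_ratio a b t * trunc_log_ratio (1 / real (Suc i)) a b t"
  have lim0: "filterlim (\<lambda>i. 1 / real (Suc i)) (at_right 0) sequentially"
    unfolding filterlim_at using LIMSEQ_inverse_real_of_nat by (auto simp: inverse_eq_divide)
  have "(\<integral>\<^sup>+t. ennreal (log_ratio a b t * log_ratio a b t) \<partial>lborel)
      \<le> (\<integral>\<^sup>+t. liminf (\<lambda>i. ennreal (?p i t)) \<partial>lborel)"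
  proof (intro nn_integral_mono_AE, use AE_lborel_not_pair[of a b] in eventually_elim)
    case (elim t)
    have "(\<lambda>i. trunc_log_ratio (1 / real (Suc i)) a b t) \<longlonglongrightarrow> log_ratio a b t"
      using elim by (intro filterlim_compose[OF trunc_log_ratio_tendsto lim0]) auto
    then have "(\<lambda>i. ennreal (?p i t)) \<longlonglongrightarrow> ennreal (log_ratio a b t * log_ratio a b t)"
      by (intro tendsto_intros)
    then show ?case by (simp add: lim_imp_Liminf)
  qed
  also have "\<dots> \<le> liminf (\<lambda>i. \<integral>\<^sup>+t. ennreal (?p i t) \<partial>lborel)"
    by (rule nn_integral_liminf) measurable
  also have "(\<lambda>i. \<integral>\<^sup>+t. ennreal (?p i t) \<partial>lborel) = (\<lambda>i. ennreal (\<integral>t. ?p i t \<partial>lborel))"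
  proof (rule ext, rule nn_integral_eq_integral)
    fix i
    show "integrable lborel (?p i)"
      using log_ratio_duality[OF assms assms, of "1 / real (Suc i)"] by (simp add: has_bochner_integral_iff)
    show "AE t in lborel. 0 \<le> ?p i t"
      using AE_lborel_not_pair[of a b] by eventually_elim (intro trunc_log_ratio_abs_le, auto)
  qed
  also have "liminf \<dots> = ennreal (pi\<^sup>2 * (\<integral>x. indicator {a..b} x * indicator {a..b} x \<partial>lborel))"
    by (intro lim_imp_Liminf tendsto_ennrealI filterlim_compose[OF log_ratio_duality_tendsto lim0] assms) simp
  finally have "(\<integral>\<^sup>+t. ennreal (log_ratio a b t * log_ratio a b t) \<partial>lborel) < \<infinity>"
    by (rule order.strict_trans1) simp
  then show ?thesis
    by (intro integrableI_nonneg) auto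
qed

lemma integrable_mult_of_squares:
  fixes f g :: "'a \<Rightarrow> real"
  assumes [measurable]: "f \<in> borel_measurable M" "g \<in> borel_measurable M"
    and "integrable M (\<lambda>t. f t * f t)" "integrable M (\<lambda>t. g t * g t)"
  shows "integrable M (\<lambda>t. f t * g t)"
proof (rule Bochner_Integration.integrable_bound[of _ "\<lambda>t. f t * f t + g t * g t"])
  have "\<bar>x * y\<bar> \<le> x * x + y * y" for x y :: real
  proof -
    have "2 * (\<bar>x\<bar> * \<bar>y\<bar>) \<le> x * x + y * y"
      using sum_squares_bound[of "\<bar>x\<bar>" "\<bar>y\<bar>"] by (simp add: power2_eq_square)
    moreover have "0 \<le> \<bar>x\<bar> * \<bar>y\<bar>" by simp
    ultimately show ?thesis unfolding abs_mult by linarith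
  qed
  then show "AE t in M. norm (f t * g t) \<le> norm (f t * f t + g t * g t)"
    by (intro AE_I2) simp
qed (use assms in auto)

text \<open>The product of two ratios is integrable by the square integrability just shown, so it
  can dominate its own truncations; the limit of the duality is then the inner product
  itself.\<close>

lemma log_ratio_inner:
  assumes "a < b" "c < d"
  shows "has_bochner_integral lborel (\<lambda>t. log_ratio a b t * log_ratio c d t)
    (pi\<^sup>2 * (\<integral>x. indicator {a..b} x * indicator {c..d} x \<partial>lborel))"
proof -
  have int: "integrable lborel (\<lambda>t. log_ratio a b t * log_ratio c d t)"
    by (rule integrable_mult_of_squares) (auto intro!: integrable_log_ratio_square assms)
  have "((\<lambda>\<epsilon>. \<integral>t. log_ratio a b t * trunc_log_ratio \<epsilon> c d t \<partial>lborel)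
     \<longlongrightarrow> (\<integral>t. log_ratio a b t * log_ratio c d t \<partial>lborel)) (at_right 0)"
  proof (rule dominated_convergence_at_right[where w = "\<lambda>t. \<bar>log_ratio a b t * log_ratio c d t\<bar>"])
    show "AE t in lborel. ((\<lambda>e. log_ratio a b t * trunc_log_ratio e c d t)
        \<longlongrightarrow> log_ratio a b t * log_ratio c d t) (at_right 0)"
      using AE_lborel_not_pair[of c d]
      by eventually_elim (intro tendsto_mult tendsto_const trunc_log_ratio_tendsto, auto)
    show "AE t in lborel. \<bar>log_ratio a b t * trunc_log_ratio e c d t\<bar> \<le> \<bar>log_ratio a b t * log_ratio c d t\<bar>"
      if "0 < e" for e
      using AE_lborel_not_pair[of c d]
      by eventually_elim
        (unfold abs_mult, intro mult_left_mono trunc_log_ratio_abs_le that, auto)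
  qed (use int in auto)
  then have "(\<integral>t. log_ratio a b t * log_ratio c d t \<partial>lborel)
      = pi\<^sup>2 * (\<integral>x. indicator {a..b} x * indicator {c..d} x \<partial>lborel)"
    using log_ratio_duality_tendsto[OF assms] by (rule tendsto_unique[rotated]) simp
  with int show ?thesis by (simp add: has_bochner_integral_iff)
qed

section \<open>Hilbert transforms of step functions\<close>

text \<open>G is the Gram matrix of the family f. Two families with the same Gram matrix give linear
  combinations of equal norm, which is how isometry is proved both for logarithmic ratios and for
  powers of Gaussians.\<close>

lemma has_bochner_integral_cmod_sum_square:
  fixes f :: "'k \<Rightarrow> 'a \<Rightarrow> real" and c :: "'k \<Rightarrow> complex"
  assumes "finite K"
    and "\<And>k l. k \<in> K \<Longrightarrow> l \<in> K \<Longrightarrow> has_bochner_integral M (\<lambda>x. f k x * f l x) (G k l)"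
  shows "has_bochner_integral M (\<lambda>x. (cmod (\<Sum>k\<in>K. c k * complex_of_real (f k x)))\<^sup>2)
     (\<Sum>k\<in>K. \<Sum>l\<in>K. Re (c k * cnj (c l)) * G k l)"
proof -
  have "(cmod (\<Sum>k\<in>K. c k * complex_of_real (f k x)))\<^sup>2
     = (\<Sum>k\<in>K. \<Sum>l\<in>K. Re (c k * cnj (c l)) * (f k x * f l x))" for x
  proof -
    let ?z = "\<Sum>k\<in>K. c k * complex_of_real (f k x)"
    have "(cmod ?z)\<^sup>2 = Re (?z * cnj ?z)"
      by (metis Re_complex_of_real complex_norm_square)
    also have "?z * cnj ?z = (\<Sum>k\<in>K. \<Sum>l\<in>K. (c k * cnj (c l)) * complex_of_real (f k x * f l x))"
      by (simp add: cnj_sum sum_product mult_ac)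
    also have "Re \<dots> = (\<Sum>k\<in>K. \<Sum>l\<in>K. Re (c k * cnj (c l)) * (f k x * f l x))"
      by (simp only: Re_sum Re_complex_of_real Im_complex_of_real times_complex.sel) simp
    finally show ?thesis .
  qed
  then show ?thesis
    using assms by (simp only:) (intro has_bochner_integral_sum has_bochner_integral_mult_right)
qed

text \<open>Reflection of the line turns |u + v|^2 into |u - v|^2, so both have the same integral,
  and the parallelogram law gives their sum. This replaces the vanishing of the inner product of u
  and v.\<close>

lemma pythagoras_even_odd:
  fixes u v :: "real \<Rightarrow> complex"
  assumes [measurable]: "u \<in> borel_measurable borel" "v \<in> borel_measurable borel"
    and even: "AE x in lborel. u (- x) = u x" and odd: "AE x in lborel. v (- x) = - v x"
    and int: "integrable lborel (\<lambda>x. (cmod (u x))\<^sup>2)" "integrable lborel (\<lambda>x. (cmod (v x))\<^sup>2)"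
  shows "integrable lborel (\<lambda>x. (cmod (u x + v x))\<^sup>2)"
    and "(\<integral>x. (cmod (u x + v x))\<^sup>2 \<partial>lborel) = (\<integral>x. (cmod (u x))\<^sup>2 \<partial>lborel) + (\<integral>x. (cmod (v x))\<^sup>2 \<partial>lborel)"
proof -
  have law: "(cmod (z + w))\<^sup>2 + (cmod (z - w))\<^sup>2 = 2 * (cmod z)\<^sup>2 + 2 * (cmod w)\<^sup>2" for z w
    unfolding cmod_power2 by (simp add: power2_eq_square algebra_simps)
  have int2: "integrable lborel (\<lambda>x. 2 * (cmod (u x))\<^sup>2 + 2 * (cmod (v x))\<^sup>2)"
    using int by simp
  have le: "(cmod (u x + v x))\<^sup>2 \<le> 2 * (cmod (u x))\<^sup>2 + 2 * (cmod (v x))\<^sup>2"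
     "(cmod (u x - v x))\<^sup>2 \<le> 2 * (cmod (u x))\<^sup>2 + 2 * (cmod (v x))\<^sup>2" for x
    using law[of "u x" "v x"] zero_le_power2[of "cmod (u x - v x)"] zero_le_power2[of "cmod (u x + v x)"]
    by linarith+
  show plus: "integrable lborel (\<lambda>x. (cmod (u x + v x))\<^sup>2)"
    by (rule Bochner_Integration.integrable_bound[OF int2]) (use le in auto)
  have minus: "integrable lborel (\<lambda>x. (cmod (u x - v x))\<^sup>2)"
    by (rule Bochner_Integration.integrable_bound[OF int2]) (use le in auto)
  have "(\<integral>x. (cmod (u x + v x))\<^sup>2 \<partial>lborel) = (\<integral>x. (cmod (u (- x) + v (- x)))\<^sup>2 \<partial>lborel)"
    by (subst lborel_integral_real_affine[of "-1" _ 0]) simp_all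
  also have "\<dots> = (\<integral>x. (cmod (u x - v x))\<^sup>2 \<partial>lborel)"
    by (intro integral_cong_AE, measurable, use even odd in eventually_elim) simp
  finally have "2 * (\<integral>x. (cmod (u x + v x))\<^sup>2 \<partial>lborel)
     = (\<integral>x. (cmod (u x + v x))\<^sup>2 + (cmod (u x - v x))\<^sup>2 \<partial>lborel)"
    using plus minus by simp
  also have "\<dots> = 2 * (\<integral>x. (cmod (u x))\<^sup>2 \<partial>lborel) + 2 * (\<integral>x. (cmod (v x))\<^sup>2 \<partial>lborel)"
    unfolding law using int by simp
  finally show "(\<integral>x. (cmod (u x + v x))\<^sup>2 \<partial>lborel)
     = (\<integral>x. (cmod (u x))\<^sup>2 \<partial>lborel) + (\<integral>x. (cmod (v x))\<^sup>2 \<partial>lborel)" by simp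
qed

section \<open>Pointwise rules for the principal value\<close>

lemma hilbert_alt:
  "hilbert f x = Lim (at_right 0) (\<lambda>\<epsilon>. complex_of_real (1 / pi) *
     (\<integral>t. f t * complex_of_real (trunc_inv \<epsilon> (x - t)) \<partial>lborel))"
proof -
  have "indicator {t. \<epsilon> < \<bar>x - t\<bar>} t *\<^sub>R (f t / complex_of_real (x - t))
      = f t * complex_of_real (trunc_inv \<epsilon> (x - t))" for \<epsilon> t
    by (simp add: trunc_inv_def indicator_def)
  then show ?thesis by (simp only: hilbert_def set_lebesgue_integral_def)
qed

lemma hilbert_eqI:
  assumes "((\<lambda>\<epsilon>. \<integral>t. f t * complex_of_real (trunc_inv \<epsilon> (x - t)) \<partial>lborel) \<longlongrightarrow> L) (at_right 0)"
  shows "hilbert f x = complex_of_real (1 / pi) * L"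
  unfolding hilbert_alt by (rule tendsto_Lim) (auto intro!: tendsto_intros assms)

text \<open>The conclusion is equality at every x, including points of E and points where the limit
  does not exist: the truncated integrals themselves agree for every \<epsilon>.\<close>

lemma hilbert_cong_finite:
  assumes "finite E" "\<And>t. t \<notin> E \<Longrightarrow> f t = g t"
  shows "hilbert f = hilbert g"
  unfolding hilbert_alt[abs_def]
  by (intro ext arg_cong2[of _ _ _ _ Lim] refl arg_cong2[of _ _ _ _ "(*)"] integral_discrete_difference[of E])
     (use assms in \<open>auto simp: countable_finite\<close>)

text \<open>Convergence at x is assumed because \<open>Lim\<close> of a divergent family is an
  unspecified value, for which the sign rule cannot be derived from the truncated integrals.\<close>

lemma hilbert_minus_of_even:
  assumes "\<And>t. f (- t) = f t"
    and "((\<lambda>\<epsilon>. \<integral>t. f t * complex_of_real (trunc_inv \<epsilon> (x - t)) \<partial>lborel) \<longlongrightarrow> L) (at_right 0)"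
  shows "hilbert f (- x) = - hilbert f x"
proof -
  have "(\<integral>t. f t * complex_of_real (trunc_inv \<epsilon> (- x - t)) \<partial>lborel)
      = - (\<integral>t. f t * complex_of_real (trunc_inv \<epsilon> (x - t)) \<partial>lborel)" for \<epsilon>
  proof -
    have "trunc_inv \<epsilon> (- x + t) = - trunc_inv \<epsilon> (x - t)" for t
      by (simp flip: trunc_inv_minus)
    then show ?thesis
      by (subst lborel_integral_real_affine[of "-1" _ 0]) (simp_all add: assms(1))
  qed
  then have "((\<lambda>\<epsilon>. \<integral>t. f t * complex_of_real (trunc_inv \<epsilon> (- x - t)) \<partial>lborel) \<longlongrightarrow> - L) (at_right 0)"
    using tendsto_minus[OF assms(2)] by simp
  then show ?thesis using hilbert_eqI[OF assms(2)] by (simp add: hilbert_eqI)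
qed

lemma trunc_integral_sum_tendsto:
  fixes g :: "'k \<Rightarrow> real \<Rightarrow> real"
  assumes "\<And>k \<epsilon>. k \<in> K \<Longrightarrow> 0 < \<epsilon> \<Longrightarrow> integrable lborel (\<lambda>t. g k t * trunc_inv \<epsilon> (x - t))"
    and "\<And>k. k \<in> K \<Longrightarrow> ((\<lambda>\<epsilon>. \<integral>t. g k t * trunc_inv \<epsilon> (x - t) \<partial>lborel) \<longlongrightarrow> L k) (at_right 0)"
  shows "((\<lambda>\<epsilon>. \<integral>t. (\<Sum>k\<in>K. c k * complex_of_real (g k t)) * complex_of_real (trunc_inv \<epsilon> (x - t)) \<partial>lborel)
     \<longlongrightarrow> (\<Sum>k\<in>K. c k * complex_of_real (L k))) (at_right 0)"
proof -
  have "((\<lambda>\<epsilon>. \<Sum>k\<in>K. c k * complex_of_real (\<integral>t. g k t * trunc_inv \<epsilon> (x - t) \<partial>lborel))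
     \<longlongrightarrow> (\<Sum>k\<in>K. c k * complex_of_real (L k))) (at_right 0)"
    by (intro tendsto_intros assms(2))
  moreover have "\<forall>\<^sub>F \<epsilon> in at_right 0. (\<Sum>k\<in>K. c k * complex_of_real (\<integral>t. g k t * trunc_inv \<epsilon> (x - t) \<partial>lborel))
     = (\<integral>t. (\<Sum>k\<in>K. c k * complex_of_real (g k t)) * complex_of_real (trunc_inv \<epsilon> (x - t)) \<partial>lborel)"
  proof (rule eventually_at_rightI[of 0 1])
    fix \<epsilon> :: real assume "\<epsilon> \<in> {0<..<1}"
    then have int: "integrable lborel (\<lambda>t. c k * complex_of_real (g k t * trunc_inv \<epsilon> (x - t)))" if "k \<in> K" for k
      using assms(1)[OF that] by (intro integrable_mult_right integrable_of_real) auto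
    have "(\<integral>t. (\<Sum>k\<in>K. c k * complex_of_real (g k t)) * complex_of_real (trunc_inv \<epsilon> (x - t)) \<partial>lborel)
       = (\<integral>t. (\<Sum>k\<in>K. c k * complex_of_real (g k t * trunc_inv \<epsilon> (x - t))) \<partial>lborel)"
      by (simp add: sum_distrib_right mult.assoc)
    also have "\<dots> = (\<Sum>k\<in>K. \<integral>t. c k * complex_of_real (g k t * trunc_inv \<epsilon> (x - t)) \<partial>lborel)"
      using int by (rule Bochner_Integration.integral_sum)
    also have "\<dots> = (\<Sum>k\<in>K. c k * complex_of_real (\<integral>t. g k t * trunc_inv \<epsilon> (x - t) \<partial>lborel))"
      by (simp only: integral_mult_right_zero integral_complex_of_real)
    finally show "(\<Sum>k\<in>K. c k * complex_of_real (\<integral>t. g k t * trunc_inv \<epsilon> (x - t) \<partial>lborel))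
     = (\<integral>t. (\<Sum>k\<in>K. c k * complex_of_real (g k t)) * complex_of_real (trunc_inv \<epsilon> (x - t)) \<partial>lborel)" ..
  qed simp
  ultimately show ?thesis by (rule Lim_transform_eventually)
qed

section \<open>Combinations of interval indicators\<close>

lemma phi_jk_eq_indicator:
  "phi_jk j k = indicator {real_of_int k / 2 powi j .. (real_of_int k + 1) / 2 powi j}"
proof
  fix t
  have "(2::real) powi j > 0" by simp
  then show "phi_jk j k t = indicator {real_of_int k / 2 powi j .. (real_of_int k + 1) / 2 powi j} t"
    by (auto simp: phi_jk_def indicator_def field_simps)
qed

lemma V_space_stepE:
  assumes "f \<in> V_space j"
  obtains K c \<alpha> \<beta> where "finite (K :: int set)" "\<And>k. k \<in> K \<Longrightarrow> \<alpha> k < \<beta> k"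
    "f = (\<lambda>t. \<Sum>k\<in>K. c k * complex_of_real (indicator {\<alpha> k .. \<beta> k} t))"
proof -
  from assms obtain K c where "finite K" "\<And>t. f t = (\<Sum>k\<in>K. c k * complex_of_real (phi_jk j k t))"
    unfolding V_space_def by blast
  then show ?thesis
    by (intro that[of K "\<lambda>k. real_of_int k / 2 powi j" "\<lambda>k. (real_of_int k + 1) / 2 powi j" c])
       (auto simp: phi_jk_eq_indicator divide_strict_right_mono fun_eq_iff)
qed

lemma has_bochner_integral_indicator_mult:
  "has_bochner_integral lborel (\<lambda>x::real. indicator {a..b} x * indicator {c..d} x)
     (\<integral>x. indicator {a..b} x * indicator {c..d} x \<partial>lborel :: real)"
proof -
  have "integrable lborel (indicator ({a..b} \<inter> {c..d}) :: real \<Rightarrow> real)"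
    by (rule integrable_real_indicator) (auto simp: emeasure_lborel_Icc_eq)
  then show ?thesis by (simp only: has_bochner_integral_iff indicator_inter_arith[abs_def] simp_thms)
qed

locale step_function =
  fixes K :: "'k set" and c :: "'k \<Rightarrow> complex" and \<alpha> \<beta> :: "'k \<Rightarrow> real"
  assumes finite_K: "finite K" and less: "\<And>k. k \<in> K \<Longrightarrow> \<alpha> k < \<beta> k"
begin

definition step :: "real \<Rightarrow> complex" where
  "step t = (\<Sum>k\<in>K. c k * complex_of_real (indicator {\<alpha> k .. \<beta> k} t))"

definition log_step :: "real \<Rightarrow> complex" where
  "log_step t = (\<Sum>k\<in>K. (c k / complex_of_real pi) * complex_of_real (log_ratio (\<alpha> k) (\<beta> k) t))"

text \<open>At an endpoint of an interval the truncated integral of its indicator diverges like ln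
  \<epsilon>, so identities for \<open>hilbert step\<close> are claimed off this set.\<close>

definition jumps :: "real set" where
  "jumps = \<alpha> ` K \<union> \<beta> ` K"

lemma finite_jumps: "finite jumps"
  using finite_K by (simp add: jumps_def)

lemma step_borel [measurable]: "step \<in> borel_measurable borel"
  unfolding step_def by measurable

lemma log_step_borel [measurable]: "log_step \<in> borel_measurable borel"
  unfolding log_step_def by measurable

lemma step_trunc_tendsto:
  assumes "x \<notin> jumps"
  shows "((\<lambda>\<epsilon>. \<integral>t. step t * complex_of_real (trunc_inv \<epsilon> (x - t)) \<partial>lborel)
     \<longlongrightarrow> (\<Sum>k\<in>K. c k * complex_of_real (log_ratio (\<alpha> k) (\<beta> k) x))) (at_right 0)"
  unfolding step_def
proof (rule trunc_integral_sum_tendsto)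
  fix k assume k: "k \<in> K"
  note int = integral_trunc_inv[OF _ less_imp_le[OF less[OF k]], of _ x, unfolded has_bochner_integral_iff]
  show "integrable lborel (\<lambda>t. indicator {\<alpha> k..\<beta> k} t * trunc_inv \<epsilon> (x - t))" if "0 < \<epsilon>" for \<epsilon>
    using int[OF that] by simp
  have "((\<lambda>\<epsilon>. trunc_log_ratio \<epsilon> (\<alpha> k) (\<beta> k) x) \<longlongrightarrow> log_ratio (\<alpha> k) (\<beta> k) x) (at_right 0)"
    using assms k by (intro trunc_log_ratio_tendsto) (auto simp: jumps_def)
  moreover have "\<forall>\<^sub>F \<epsilon> in at_right 0. trunc_log_ratio \<epsilon> (\<alpha> k) (\<beta> k) x
      = (\<integral>t. indicator {\<alpha> k..\<beta> k} t * trunc_inv \<epsilon> (x - t) \<partial>lborel)"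
    by (rule eventually_at_rightI[of 0 1]) (use int in auto)
  ultimately show "((\<lambda>\<epsilon>. \<integral>t. indicator {\<alpha> k..\<beta> k} t * trunc_inv \<epsilon> (x - t) \<partial>lborel)
      \<longlongrightarrow> log_ratio (\<alpha> k) (\<beta> k) x) (at_right 0)"
    by (rule Lim_transform_eventually)
qed

lemma hilbert_step: "x \<notin> jumps \<Longrightarrow> hilbert step x = log_step x"
  by (simp add: hilbert_eqI[OF step_trunc_tendsto] log_step_def sum_distrib_left sum_divide_distrib)

text \<open>The inner transform is known only off \<open>jumps\<close>, but by
  \<open>hilbert_cong_finite\<close> it may be replaced by \<open>log_step\<close> inside the outer
  one. Each logarithmic ratio then returns minus pi^2 times its indicator.\<close>

lemma hilbert_hilbert_step:
  assumes "x \<notin> jumps"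
  shows "hilbert (hilbert step) x = - step x"
proof -
  have "((\<lambda>\<epsilon>. \<integral>t. log_step t * complex_of_real (trunc_inv \<epsilon> (x - t)) \<partial>lborel)
     \<longlongrightarrow> (\<Sum>k\<in>K. (c k / complex_of_real pi) * complex_of_real (- pi\<^sup>2 * indicator {\<alpha> k..\<beta> k} x))) (at_right 0)"
    unfolding log_step_def
    using assms
    by (intro trunc_integral_sum_tendsto integrable_log_ratio_trunc_inv integral_log_ratio_trunc_inv_tendsto less)
       (auto simp: jumps_def)
  then have "hilbert log_step x = - step x"
    by (simp add: hilbert_eqI step_def sum_distrib_left power2_eq_square sum_negf)
  then show ?thesis
    using hilbert_cong_finite[OF finite_jumps hilbert_step] by simp
qed

lemma hilbert_step_borel: "hilbert step \<in> borel_measurable borel"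
proof -
  have "hilbert step \<in> borel_measurable lborel"
    by (rule measurable_discrete_difference[of log_step _ _ jumps])
       (use hilbert_step finite_jumps in \<open>auto simp: countable_finite\<close>)
  then show ?thesis by simp
qed

lemma AE_hilbert_step: "AE x in lborel. hilbert step x = log_step x"
  using AE_lborel_not_in_finite[OF finite_jumps] by eventually_elim (rule hilbert_step)

lemma step_square_integral:
  "has_bochner_integral lborel (\<lambda>t. (cmod (step t))\<^sup>2)
    (\<Sum>k\<in>K. \<Sum>l\<in>K. Re (c k * cnj (c l)) * (\<integral>x. indicator {\<alpha> k..\<beta> k} x * indicator {\<alpha> l..\<beta> l} x \<partial>lborel))"
  unfolding step_def
  by (intro has_bochner_integral_cmod_sum_square finite_K has_bochner_integral_indicator_mult)

text \<open>The Gram matrix of the logarithmic ratios is pi^2 times that of the indicators, and the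
  coefficients of \<open>log_step\<close> carry the compensating factor 1/pi.\<close>

lemma hilbert_step_square_integral:
  "has_bochner_integral lborel (\<lambda>t. (cmod (hilbert step t))\<^sup>2) (\<integral>t. (cmod (step t))\<^sup>2 \<partial>lborel)"
proof -
  let ?I = "\<lambda>k l. \<integral>x. indicator {\<alpha> k..\<beta> k} x * indicator {\<alpha> l..\<beta> l} x \<partial>lborel"
  have "has_bochner_integral lborel (\<lambda>t. (cmod (log_step t))\<^sup>2)
    (\<Sum>k\<in>K. \<Sum>l\<in>K. Re (c k / complex_of_real pi * cnj (c l / complex_of_real pi)) * (pi\<^sup>2 * ?I k l))"
    unfolding log_step_def
    by (intro has_bochner_integral_cmod_sum_square finite_K log_ratio_inner less)
  also have "(\<Sum>k\<in>K. \<Sum>l\<in>K. Re (c k / complex_of_real pi * cnj (c l / complex_of_real pi)) * (pi\<^sup>2 * ?I k l))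
     = (\<integral>t. (cmod (step t))\<^sup>2 \<partial>lborel)"
  proof -
    have Re_div: "Re (z / complex_of_real pi * cnj (w / complex_of_real pi)) = Re (z * cnj w) / pi\<^sup>2" for z w
      by (simp add: power2_eq_square add_divide_distrib)
    have "(\<Sum>k\<in>K. \<Sum>l\<in>K. Re (c k / complex_of_real pi * cnj (c l / complex_of_real pi)) * (pi\<^sup>2 * ?I k l))
       = (\<Sum>k\<in>K. \<Sum>l\<in>K. Re (c k * cnj (c l)) * ?I k l)"
      unfolding Re_div by (intro sum.cong refl) (simp del: times_complex.sel)
    then show ?thesis
      using step_square_integral by (simp add: has_bochner_integral_iff)
  qed
  finally have log: "has_bochner_integral lborel (\<lambda>t. (cmod (log_step t))\<^sup>2) (\<integral>t. (cmod (step t))\<^sup>2 \<partial>lborel)" .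
  note [measurable] = hilbert_step_borel
  show ?thesis
    by (rule has_bochner_integral_cong_AE[THEN iffD2, OF _ _ _ log])
       (measurable, use AE_hilbert_step in eventually_elim, simp)
qed

lemma hilbert_step_odd:
  assumes "\<And>t. step (- t) = step t"
  shows "AE x in lborel. hilbert step (- x) = - hilbert step x"
  using AE_lborel_not_in_finite[OF finite_jumps]
  by eventually_elim (rule hilbert_minus_of_even[OF assms step_trunc_tendsto])

end

section \<open>The kernel c and generalized Gaussians\<close>

text \<open>Substitute u = s t^(2n) in Euler's integral for Gamma. The derivative contributes
  t^(2n-1), and the exponent 2n - 1 + 2n (z - 1) equals 2nl precisely for this z.\<close>

lemma has_integral_Gamma_power:
  fixes l n :: nat and s :: real
  assumes "n \<ge> 1" "0 < s"
  defines "z \<equiv> real l + 1 / (2 * real n)"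
  shows "((\<lambda>t. t ^ (2 * n * l) * exp (- (s * t ^ (2 * n)))) has_integral
     (Gamma z * s powr (- z) / (2 * real n))) {0<..}"
proof -
  have z: "z > 0" using assms by (simp add: z_def add_nonneg_pos)
  let ?h = "\<lambda>u. u powr (z - 1) / exp u"
  let ?g = "\<lambda>t. s * t ^ (2 * n)"
  let ?g' = "\<lambda>t. s * (real (2 * n) * t ^ (2 * n - 1))"
  have image: "?g ` {0<..} = {0<..}"
  proof (intro equalityI subsetI)
    fix u :: real assume "u \<in> {0<..}"
    then have "u = ?g (root (2 * n) (u / s))" "root (2 * n) (u / s) \<in> {0<..}"
      using assms by (auto simp: real_root_pow_pos2)
    then show "u \<in> ?g ` {0<..}" by blast
  qed (use assms in auto)
  have inj: "inj_on ?g {0<..}"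
  proof (rule inj_onI)
    fix x y assume "x \<in> {0<..}" "y \<in> {0<..}" "?g x = ?g y"
    then show "x = y" using assms by (intro power_eq_imp_eq_base[of x "2 * n" y]) auto
  qed
  have "(?h has_integral Gamma z) {0<..}"
    by (rule has_integral_spike_set_eq[THEN iffD1, OF _ _ Gamma_integral_real[OF z]])
       (rule negligible_subset[of "{0}"], auto)+
  then have "?h absolutely_integrable_on (?g ` {0<..}) \<and> integral (?g ` {0<..}) ?h = Gamma z"
    unfolding image by (auto intro!: nonnegative_absolutely_integrable_1 simp: integral_unique)
  moreover have "(?g has_field_derivative ?g' t) (at t within {0<..})" for t
    by (auto intro!: derivative_eq_intros)
  ultimately have "(\<lambda>t. \<bar>?g' t\<bar> * ?h (?g t)) absolutely_integrable_on {0<..}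
      \<and> integral {0<..} (\<lambda>t. \<bar>?g' t\<bar> * ?h (?g t)) = Gamma z"
    by (subst has_absolute_integral_change_of_variables_1'[OF _ _ inj]) auto
  then have "((\<lambda>t. \<bar>?g' t\<bar> * ?h (?g t)) has_integral Gamma z) {0<..}"
    by (auto dest!: set_lebesgue_integral_eq_integral(1) simp: has_integral_integral)
  then have "((\<lambda>t. s powr (- z) / (2 * real n) * (\<bar>?g' t\<bar> * ?h (?g t))) has_integral
      s powr (- z) / (2 * real n) * Gamma z) {0<..}"
    by (rule has_integral_mult_right)
  moreover have "s powr (- z) / (2 * real n) * (\<bar>?g' t\<bar> * ?h (?g t))
      = t ^ (2 * n * l) * exp (- (s * t ^ (2 * n)))" if "t \<in> {0<..}" for t
  proof -
    have t: "t > 0" using that by simp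
    have "(t ^ (2 * n)) powr (z - 1) = t powr (real (2 * n) * (z - 1))"
      by (subst powr_realpow[OF t, symmetric]) (rule powr_powr)
    moreover have "t ^ (2 * n - 1) = t powr real (2 * n - 1)"
      by (rule powr_realpow[OF t, symmetric])
    ultimately have "t ^ (2 * n - 1) * (t ^ (2 * n)) powr (z - 1) = t powr (real (2 * n - 1) + real (2 * n) * (z - 1))"
      by (simp only: powr_add)
    also have "real (2 * n - 1) + real (2 * n) * (z - 1) = real (2 * n * l)"
      using assms(1) by (simp add: z_def of_nat_diff field_simps)
    also have "t powr real (2 * n * l) = t ^ (2 * n * l)"
      using t by (rule powr_realpow)
    finally have pow: "t ^ (2 * n - 1) * (t ^ (2 * n)) powr (z - 1) = t ^ (2 * n * l)" .
    have "s powr (- z) * s * s powr (z - 1) = s powr (- z + 1 + (z - 1))"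
      using assms(2) by (simp only: powr_add powr_one)
    then have spow: "s powr (- z) * s * s powr (z - 1) = 1" using assms(2) by simp
    have "s powr (- z) / (2 * real n) * (\<bar>?g' t\<bar> * ?h (?g t))
       = (s powr (- z) * s * s powr (z - 1)) * (t ^ (2 * n - 1) * (t ^ (2 * n)) powr (z - 1))
           * exp (- (s * t ^ (2 * n)))"
    proof -
      have "\<bar>?g' t\<bar> = ?g' t"
        by (intro abs_of_nonneg mult_nonneg_nonneg zero_le_power) (use t assms in auto)
      moreover have "?h (?g t) = s powr (z - 1) * (t ^ (2 * n)) powr (z - 1) * exp (- (s * t ^ (2 * n)))"
        by (subst powr_mult) (use t assms in \<open>auto simp only: exp_minus divide_inverse\<close>)
      moreover have "p / (2 * real n) * (s * (real (2 * n) * q) * (v * w * e)) = p * s * v * (q * w) * e" for p q v w e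
        using assms(1) by simp
      ultimately show ?thesis by (simp only:)
    qed
    then show ?thesis unfolding pow spow by simp
  qed
  ultimately have "((\<lambda>t. t ^ (2 * n * l) * exp (- (s * t ^ (2 * n)))) has_integral
      s powr (- z) / (2 * real n) * Gamma z) {0<..}"
    by (rule has_integral_eq[rotated])
  then show ?thesis by (simp only: mult.commute[of "Gamma z"] times_divide_eq_left)
qed

lemma gaussian_moment:
  fixes l n :: nat and s :: real
  assumes "n \<ge> 1" "0 < s"
  defines "z \<equiv> real l + 1 / (2 * real n)"
  shows "has_bochner_integral lborel (\<lambda>t. t ^ (2 * n * l) * exp (- (s * t ^ (2 * n))))
     (Gamma z * s powr (- z) / real n)"
proof -
  let ?f = "\<lambda>t. t ^ (2 * n * l) * exp (- (s * t ^ (2 * n)))"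
  have z: "z > 0" using assms by (simp add: z_def add_nonneg_pos)
  have nonneg: "0 \<le> ?f t" for t by (simp add: power_mult)
  have "((\<lambda>t. if t \<in> {0<..} then ?f t else 0) has_integral (Gamma z * s powr (- z) / (2 * real n))) UNIV"
    using has_integral_Gamma_power[OF assms(1,2), of l]
    by (simp only: has_integral_restrict_UNIV z_def)
  then have "(\<integral>\<^sup>+t. ennreal (if t \<in> {0<..} then ?f t else 0) \<partial>lborel) = ennreal (Gamma z * s powr (- z) / (2 * real n))"
    by (intro nn_integral_has_integral_lborel) (use nonneg in auto)
  also have "(\<integral>\<^sup>+t. ennreal (if t \<in> {0<..} then ?f t else 0) \<partial>lborel) = (\<integral>\<^sup>+t. ennreal (?f t) * indicator {0<..} t \<partial>lborel)"
    by (intro nn_integral_cong) auto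
  finally have half: "(\<integral>\<^sup>+t. ennreal (?f t) * indicator {0<..} t \<partial>lborel) = ennreal (Gamma z * s powr (- z) / (2 * real n))" .
  have "(\<integral>\<^sup>+t. ennreal (?f t) \<partial>lborel) = 2 * ennreal (Gamma z * s powr (- z) / (2 * real n))"
    by (subst nn_integral_even) (simp_all add: half)
  also have "\<dots> = ennreal (2 * (Gamma z * s powr (- z) / (2 * real n)))"
    by (subst ennreal_mult') simp_all
  also have "2 * (Gamma z * s powr (- z) / (2 * real n)) = Gamma z * s powr (- z) / real n"
    by simp
  finally show ?thesis
    using z nonneg by (intro has_bochner_integral_nn_integral AE_I2) (auto intro!: divide_nonneg_nonneg mult_nonneg_nonneg less_imp_le[OF Gamma_real_pos])
qed

section \<open>The power series of c_n and its transform of a Gaussian\<close>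

definition c_coeff :: "nat \<Rightarrow> nat \<Rightarrow> real" where
  "c_coeff n l = (- 1) ^ l * real n /
     ((2 * real n) powr (2 * real l + 1 / (2 * real n)) * Gamma (real l + 1 / (2 * real n)) * fact l)"

lemma c_fun_eq_suminf: "c_fun n \<eta> = (\<Sum>l. c_coeff n l * \<eta> ^ (2 * n * l))"
  by (simp add: c_fun_def c_coeff_def)

lemma c_fun_borel [measurable]: "c_fun n \<in> borel_measurable borel"
  unfolding c_fun_eq_suminf[abs_def] by measurable

lemma c_fun_minus: "c_fun n (- \<eta>) = c_fun n \<eta>"
  by (simp add: c_fun_eq_suminf power_mult)

text \<open>A lower bound uniform in l, so that the coefficients of c_n are at most a constant over
  l!. At l = 0 it amounts to x \<le> 1, at l = 1 it is the functional equation, and from then on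
  each step multiplies Gamma by a factor l + x of at least 1.\<close>

lemma Gamma_add_nat_ge:
  assumes "0 < x" "x \<le> (1::real)"
  shows "x * Gamma x \<le> Gamma (real l + x)"
proof (induction l)
  case 0
  then show ?case using assms by (simp add: mult_left_le_one_le)
next
  case (Suc l)
  have rec: "Gamma (real l + x + 1) = (real l + x) * Gamma (real l + x)"
    using assms by (intro Gamma_plus1) (auto dest: nonpos_Ints_nonpos)
  show ?case
  proof (cases l)
    case 0
    then show ?thesis using rec by (simp add: add_ac)
  next
    case (Suc m)
    have "1 * Gamma (real l + x) \<le> (real l + x) * Gamma (real l + x)"
      using assms Suc by (intro mult_right_mono less_imp_le[OF Gamma_real_pos]) auto
    then show ?thesis using rec Suc.IH by (simp add: add_ac)
  qed
qed

lemma c_coeff_bound: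
  assumes "n \<ge> 1"
  defines "a \<equiv> 1 / (2 * real n)"
  shows "\<bar>c_coeff n l\<bar> \<le> real n / (a * Gamma a) / fact l"
proof -
  have a: "0 < a" "a \<le> 1" using assms by (auto simp: field_simps)
  have G: "a * Gamma a \<le> Gamma (real l + a)" "0 < a * Gamma a"
    using Gamma_add_nat_ge[OF a] a by auto
  have "1 \<le> (2 * real n) powr (2 * real l + a)"
    using assms a by (intro ge_one_powr_ge_zero) auto
  then have "1 * (a * Gamma a) * fact l \<le> (2 * real n) powr (2 * real l + a) * Gamma (real l + a) * fact l"
    using G by (intro mult_right_mono mult_mono) auto
  then have "real n / ((2 * real n) powr (2 * real l + a) * Gamma (real l + a) * fact l) \<le> real n / (a * Gamma a * fact l)"
  proof (intro divide_left_mono mult_pos_pos)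
    show "0 < Gamma (real l + a)" using a by (intro Gamma_real_pos) auto
  qed (use assms(1) a in auto)
  moreover have "0 < Gamma (real l + a)" using a by (intro Gamma_real_pos) auto
  ultimately show ?thesis
    by (simp add: c_coeff_def abs_mult abs_divide power_abs a_def)
qed

lemma summable_c_fun:
  assumes "n \<ge> 1"
  shows "summable (\<lambda>l. norm (c_coeff n l * \<eta> ^ (2 * n * l)))"
proof (rule summable_comparison_test')
  define C where "C = real n / (1 / (2 * real n) * Gamma (1 / (2 * real n)))"
  show "summable (\<lambda>l. C * (inverse (fact l) * (\<eta> ^ (2 * n)) ^ l))"
    by (intro summable_mult summable_exp)
  show "norm (norm (c_coeff n l * \<eta> ^ (2 * n * l))) \<le> C * (inverse (fact l) * (\<eta> ^ (2 * n)) ^ l)" if "l \<ge> 0" for l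
  proof -
    have nonneg: "0 \<le> \<eta> ^ (2 * n * l)" by (simp add: power_mult)
    have "norm (norm (c_coeff n l * \<eta> ^ (2 * n * l))) = \<bar>c_coeff n l\<bar> * \<eta> ^ (2 * n * l)"
      unfolding real_norm_def abs_abs abs_mult abs_of_nonneg[OF nonneg] ..
    also have "\<dots> \<le> C / fact l * \<eta> ^ (2 * n * l)"
      unfolding C_def by (intro mult_right_mono c_coeff_bound assms nonneg)
    also have "\<dots> = C * (inverse (fact l) * (\<eta> ^ (2 * n)) ^ l)"
      unfolding power_mult divide_inverse mult.assoc ..
    finally show ?thesis .
  qed
qed

text \<open>The Gamma value in the l-th coefficient cancels the one in the l-th moment, and what
  remains is the exponential series at -x. With absolute values inside the integrals the same
  computation gives the series at x, whose convergence justifies the termwise integration.\<close>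

lemma gaussian_transform:
  assumes "n \<ge> 1" "0 < s"
  shows "has_bochner_integral lborel (\<lambda>t. c_fun n (\<omega> * t) * exp (- (s * t ^ (2 * n))))
     ((2 * real n * s) powr (- 1 / (2 * real n)) * exp (- (\<omega> ^ (2 * n) / (4 * (real n)\<^sup>2 * s))))"
proof -
  define a where "a = 1 / (2 * real n)"
  define x where "x = \<omega> ^ (2 * n) / (4 * (real n)\<^sup>2 * s)"
  have a: "a > 0" using assms by (simp add: a_def)
  have x: "x \<ge> 0" using assms by (simp add: x_def)
  let ?f = "\<lambda>l t. c_coeff n l * (\<omega> * t) ^ (2 * n * l) * exp (- (s * t ^ (2 * n)))"
  note mom = gaussian_moment[OF assms, folded a_def, unfolded has_bochner_integral_iff]
  have eq: "?f l t = c_coeff n l * \<omega> ^ (2 * n * l) * (t ^ (2 * n * l) * exp (- (s * t ^ (2 * n))))" for l t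
    by (simp add: power_mult_distrib)
  have val: "c_coeff n l * \<omega> ^ (2 * n * l) * (Gamma (real l + a) * s powr (- (real l + a)) / real n)
      = (2 * real n * s) powr (- a) * ((- x) ^ l /\<^sub>R fact l)" for l
  proof -
    have G: "Gamma (real l + a) > 0" using a by (intro Gamma_real_pos) auto
    have pow2: "(2 * real n) powr (2 * real l + a) = (4 * (real n)\<^sup>2) ^ l * (2 * real n) powr a"
    proof -
      have "(2 * real n) powr (2 * real l) = (2 * real n) powr real (2 * l)" by simp
      also have "\<dots> = ((2 * real n)\<^sup>2) ^ l"
        using assms by (subst powr_realpow) (auto simp: power_mult)
      finally show ?thesis by (simp add: powr_add power_mult_distrib)
    qed
    have "s powr (- (real l + a)) = 1 / (s ^ l * s powr a)"
    proof -
      have "s powr (- (real l + a)) = inverse (s powr (real l + a))" by (rule powr_minus)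
      then show ?thesis using assms by (simp add: powr_add powr_realpow divide_inverse)
    qed
    moreover have "(2 * real n * s) powr (- a) = 1 / ((2 * real n) powr a * s powr a)"
      using assms by (simp add: powr_minus powr_mult divide_inverse)
    moreover have "(- x) ^ l = (- 1) ^ l * \<omega> ^ (2 * n * l) / ((4 * (real n)\<^sup>2) ^ l * s ^ l)"
    proof -
      have "x ^ l = \<omega> ^ (2 * n * l) / ((4 * (real n)\<^sup>2) ^ l * s ^ l)"
        unfolding x_def power_divide power_mult_distrib power_mult ..
      then show ?thesis by (subst power_minus) simp
    qed
    ultimately show ?thesis
    proof (simp only:)
      have regroup: "m * N / (P * A * G' * F) * W * (G' * (1 / (S * T)) / N) = 1 / (A * T) * (m * W / (P * S) /\<^sub>R F)"
        if "G' \<noteq> 0" "N \<noteq> 0" for m N P A G' F W S T :: real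
        using that by (simp add: divide_inverse) (simp add: field_simps)
      show "c_coeff n l * \<omega> ^ (2 * n * l) * (Gamma (real l + a) * (1 / (s ^ l * s powr a)) / real n)
        = 1 / ((2 * real n) powr a * s powr a) * ((- 1) ^ l * \<omega> ^ (2 * n * l) / ((4 * (real n)\<^sup>2) ^ l * s ^ l) /\<^sub>R fact l)"
        unfolding c_coeff_def a_def[symmetric] pow2 using G assms by (intro regroup) auto
    qed
  qed
  have int: "integrable lborel (?f l)" for l
    unfolding eq using mom by (intro integrable_mult_right) simp
  have Int: "(\<integral>t. ?f l t \<partial>lborel) = (2 * real n * s) powr (- a) * ((- x) ^ l /\<^sub>R fact l)" for l
    unfolding eq integral_mult_right_zero conjunct2[OF mom[of l]] by (rule val)
  have normInt: "(\<integral>t. norm (?f l t) \<partial>lborel) = (2 * real n * s) powr (- a) * (x ^ l /\<^sub>R fact l)" for l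
  proof -
    have "norm (?f l t) = \<bar>c_coeff n l * \<omega> ^ (2 * n * l)\<bar> * (t ^ (2 * n * l) * exp (- (s * t ^ (2 * n))))" for t
      unfolding eq by (simp add: abs_mult power_mult)
    then have "(\<integral>t. norm (?f l t) \<partial>lborel)
       = \<bar>c_coeff n l * \<omega> ^ (2 * n * l)\<bar> * (Gamma (real l + a) * s powr (- (real l + a)) / real n)"
      by (simp only: integral_mult_right_zero conjunct2[OF mom[of l]])
    also have "\<dots> = \<bar>c_coeff n l * \<omega> ^ (2 * n * l) * (Gamma (real l + a) * s powr (- (real l + a)) / real n)\<bar>"
      using a by (simp add: abs_mult abs_divide)
    also have "\<dots> = (2 * real n * s) powr (- a) * (x ^ l /\<^sub>R fact l)"
      unfolding val using x by (simp add: abs_mult power_abs)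
    finally show ?thesis .
  qed
  have sm: "AE t in lborel. summable (\<lambda>l. norm (?f l t))"
  proof (intro AE_I2)
    fix t
    show "summable (\<lambda>l. norm (?f l t))"
      using summable_mult2[OF summable_c_fun[OF assms(1), of "\<omega> * t"], of "exp (- (s * t ^ (2 * n)))"]
      by (simp add: abs_mult)
  qed
  have sI: "summable (\<lambda>l. \<integral>t. norm (?f l t) \<partial>lborel)"
    unfolding normInt by (intro summable_mult summable_exp_generic)
  have sum_eq: "(\<Sum>l. ?f l t) = c_fun n (\<omega> * t) * exp (- (s * t ^ (2 * n)))" for t
    unfolding c_fun_eq_suminf
    by (rule suminf_mult2[OF summable_norm_cancel[OF summable_c_fun[OF assms(1)]], symmetric])
  have "integrable lborel (\<lambda>t. c_fun n (\<omega> * t) * exp (- (s * t ^ (2 * n))))"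
    using integrable_suminf[OF int sm sI] by (simp only: sum_eq)
  moreover have "(\<lambda>l. (2 * real n * s) powr (- a) * ((- x) ^ l /\<^sub>R fact l)) sums
     (\<integral>t. c_fun n (\<omega> * t) * exp (- (s * t ^ (2 * n))) \<partial>lborel)"
    using sums_integral[OF int sm sI] by (simp only: sum_eq Int)
  moreover have "(\<lambda>l. (2 * real n * s) powr (- a) * ((- x) ^ l /\<^sub>R fact l)) sums
     ((2 * real n * s) powr (- a) * exp (- x))"
    by (intro sums_mult exp_converges)
  ultimately show ?thesis
    by (auto simp: has_bochner_integral_iff a_def x_def dest: sums_unique2)
qed

section \<open>The isometry on limits of generalized Gaussians\<close>

definition gauss :: "nat \<Rightarrow> real \<Rightarrow> real" where
  "gauss n t = exp (- (t ^ (2 * n)))"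

definition gauss_poly :: "nat \<Rightarrow> real poly \<Rightarrow> real \<Rightarrow> real" where
  "gauss_poly n q t = gauss n t * poly q (gauss n t)"

definition c_transform :: "nat \<Rightarrow> (real \<Rightarrow> real) \<Rightarrow> real \<Rightarrow> real" where
  "c_transform n f \<omega> = (\<integral>t. c_fun n (\<omega> * t) * f t \<partial>lborel)"

lemma gauss_borel [measurable]: "gauss n \<in> borel_measurable borel"
  unfolding gauss_def by measurable

lemma gauss_poly_borel [measurable]: "gauss_poly n q \<in> borel_measurable borel"
proof -
  have "poly q \<in> borel_measurable borel"
    by (intro borel_measurable_continuous_onI continuous_intros)
  then show ?thesis unfolding gauss_poly_def by measurable
qed

lemma c_transform_borel:
  assumes [measurable]: "f \<in> borel_measurable borel"
  shows "c_transform n f \<in> borel_measurable borel"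
  unfolding c_transform_def by measurable

lemma gauss_pos: "0 < gauss n t" and gauss_le_1: "gauss n t \<le> 1"
  by (simp_all add: gauss_def power_mult)

lemma gauss_power: "gauss n t ^ k = exp (- (real k * t ^ (2 * n)))"
  by (simp add: gauss_def flip: exp_of_nat_mult)

lemma gauss_poly_eq_sum: "gauss_poly n q t = (\<Sum>k\<le>degree q. coeff q k * gauss n t ^ Suc k)"
  by (simp add: gauss_poly_def poly_altdef sum_distrib_left mult_ac)

lemma integrable_gauss_power:
  assumes "n \<ge> 1" "k \<ge> 1"
  shows "integrable lborel (\<lambda>t. gauss n t ^ k)"
  using gaussian_moment[of n "real k" 0] assms by (simp add: gauss_power has_bochner_integral_iff)

lemma integrable_c_fun_gauss_power:
  assumes "n \<ge> 1" "k \<ge> 1"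
  shows "integrable lborel (\<lambda>t. c_fun n (\<omega> * t) * gauss n t ^ k)"
  using gaussian_transform[of n "real k" \<omega>] assms by (simp add: gauss_power has_bochner_integral_iff)

lemma integrable_c_fun_gauss_poly:
  assumes "n \<ge> 1"
  shows "integrable lborel (\<lambda>t. c_fun n (\<omega> * t) * gauss_poly n q t)"
proof -
  have "integrable lborel (\<lambda>t. \<Sum>k\<le>degree q. coeff q k * (c_fun n (\<omega> * t) * gauss n t ^ Suc k))"
    by (intro Bochner_Integration.integrable_sum integrable_mult_right integrable_c_fun_gauss_power assms) simp
  then show ?thesis by (simp add: gauss_poly_eq_sum sum_distrib_left mult_ac)
qed

text \<open>Integrability of c_n against \<open>gauss n\<close> is known from
  \<open>gaussian_transform\<close>; domination by a multiple of \<open>gauss n\<close> therefore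
  carries it over to functions for which no explicit transform is available.\<close>

lemma integrable_c_fun_dominated:
  assumes "n \<ge> 1" and [measurable]: "f \<in> borel_measurable borel"
    and "\<And>t. \<bar>f t\<bar> \<le> M * gauss n t"
  shows "integrable lborel (\<lambda>t. c_fun n (\<omega> * t) * f t)"
proof (rule Bochner_Integration.integrable_bound)
  show "integrable lborel (\<lambda>t. M * (c_fun n (\<omega> * t) * gauss n t))"
    using integrable_c_fun_gauss_power[OF assms(1), of 1 \<omega>] by simp
  have "\<bar>c_fun n (\<omega> * t) * f t\<bar> \<le> \<bar>c_fun n (\<omega> * t)\<bar> * \<bar>M * gauss n t\<bar>" for t
    unfolding abs_mult[of "c_fun n (\<omega> * t)"] using assms(3)[of t] by (intro mult_left_mono) auto
  then show "AE t in lborel. norm (c_fun n (\<omega> * t) * f t) \<le> norm (M * (c_fun n (\<omega> * t) * gauss n t))"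
    by (intro AE_I2) (simp add: abs_mult mult_ac)
qed measurable

lemma c_transform_gauss_power:
  assumes "n \<ge> 1" "0 < k"
  shows "c_transform n (\<lambda>t. gauss n t ^ k) \<omega>
    = (2 * real n * real k) powr (- 1 / (2 * real n)) * exp (- (\<omega> ^ (2 * n) / (4 * (real n)\<^sup>2 * real k)))"
  using gaussian_transform[of n "real k" \<omega>] assms
  by (simp add: c_transform_def gauss_power has_bochner_integral_iff)

lemma c_transform_gauss_poly:
  assumes "n \<ge> 1"
  shows "c_transform n (gauss_poly n q) \<omega> = (\<Sum>k\<le>degree q. coeff q k * c_transform n (\<lambda>t. gauss n t ^ Suc k) \<omega>)"
proof -
  have int: "integrable lborel (\<lambda>t. coeff q k * (c_fun n (\<omega> * t) * gauss n t ^ Suc k))" for k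
    by (intro integrable_mult_right integrable_c_fun_gauss_power assms) simp
  have "c_transform n (gauss_poly n q) \<omega>
      = (\<integral>t. (\<Sum>k\<le>degree q. coeff q k * (c_fun n (\<omega> * t) * gauss n t ^ Suc k)) \<partial>lborel)"
    by (simp add: c_transform_def gauss_poly_eq_sum sum_distrib_left mult_ac)
  also have "\<dots> = (\<Sum>k\<le>degree q. \<integral>t. coeff q k * (c_fun n (\<omega> * t) * gauss n t ^ Suc k) \<partial>lborel)"
    using int by (rule Bochner_Integration.integral_sum)
  finally show ?thesis
    by (simp only: integral_mult_right_zero c_transform_def)
qed

text \<open>On the transformed side the rates 1/(4 n^2 k) and 1/(4 n^2 l) add up to s. Together with
  the prefactors this gives (2nk)(2nl)s = k + l, the rate of the product of the two original
  Gaussians, so both inner products are the same constant G.\<close>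

lemma c_transform_gauss_power_inner:
  assumes "n \<ge> 1" "0 < k" "0 < l"
  defines "G \<equiv> Gamma (1 / (2 * real n)) * (real k + real l) powr (- 1 / (2 * real n)) / real n"
  shows "has_bochner_integral lborel (\<lambda>t. gauss n t ^ k * gauss n t ^ l) G"
    and "has_bochner_integral lborel
      (\<lambda>\<omega>. c_transform n (\<lambda>t. gauss n t ^ k) \<omega> * c_transform n (\<lambda>t. gauss n t ^ l) \<omega>) G"
proof -
  show "has_bochner_integral lborel (\<lambda>t. gauss n t ^ k * gauss n t ^ l) G"
  proof -
    have "gauss n t ^ k * gauss n t ^ l = exp (- (real (k + l) * t ^ (2 * n)))" for t
      unfolding power_add[symmetric] by (rule gauss_power)
    then show ?thesis
      using gaussian_moment[of n "real (k + l)" 0] assms by (simp add: G_def)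
  qed
  let ?a = "- 1 / (2 * real n)"
  define N where "N = real n"
  have N: "N > 0" using assms by (simp add: N_def)
  define s where "s = (1 / real k + 1 / real l) / (4 * N\<^sup>2)"
  have s: "s > 0" unfolding s_def using assms(2,3) N by (intro divide_pos_pos add_pos_pos) auto
  have "has_bochner_integral lborel (\<lambda>\<omega>. ((2 * N * real k) powr ?a * (2 * N * real l) powr ?a) * exp (- (s * \<omega> ^ (2 * n))))
     (((2 * N * real k) powr ?a * (2 * N * real l) powr ?a) * (Gamma (1 / (2 * real n)) * s powr ?a / real n))"
    using gaussian_moment[OF assms(1) s, of 0] by (intro has_bochner_integral_mult_right) simp
  also have "(\<lambda>\<omega>. ((2 * N * real k) powr ?a * (2 * N * real l) powr ?a) * exp (- (s * \<omega> ^ (2 * n))))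
    = (\<lambda>\<omega>. c_transform n (\<lambda>t. gauss n t ^ k) \<omega> * c_transform n (\<lambda>t. gauss n t ^ l) \<omega>)"
  proof
    fix \<omega> :: real
    have "exp (- (s * \<omega> ^ (2 * n))) = exp (- (\<omega> ^ (2 * n) / (4 * N\<^sup>2 * real k))) * exp (- (\<omega> ^ (2 * n) / (4 * N\<^sup>2 * real l)))"
      unfolding exp_add[symmetric] s_def using assms(2,3) N by (simp add: field_simps)
    then show "((2 * N * real k) powr ?a * (2 * N * real l) powr ?a) * exp (- (s * \<omega> ^ (2 * n)))
       = c_transform n (\<lambda>t. gauss n t ^ k) \<omega> * c_transform n (\<lambda>t. gauss n t ^ l) \<omega>"
      unfolding c_transform_gauss_power[OF assms(1,2)] c_transform_gauss_power[OF assms(1,3)] N_def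
      by (simp only: mult_ac)
  qed
  also have "((2 * N * real k) powr ?a * (2 * N * real l) powr ?a) * (Gamma (1 / (2 * real n)) * s powr ?a / real n) = G"
  proof -
    have "(2 * N * real k) powr ?a * (2 * N * real l) powr ?a * s powr ?a = ((2 * N * real k) * (2 * N * real l) * s) powr ?a"
    proof -
      have "x powr r * y powr r * z powr r = (x * y * z) powr r" if "0 < x" "0 < y" "0 < z" for x y z r :: real
        using that by (simp add: powr_mult)
      then show ?thesis using N s assms(2,3) by simp
    qed
    also have "(2 * N * real k) * (2 * N * real l) * s = real k + real l"
      using N assms(2,3) by (simp add: s_def field_simps power2_eq_square)
    finally have "(2 * N * real k) powr ?a * (2 * N * real l) powr ?a * s powr ?a = (real k + real l) powr ?a" .
    then show ?thesis by (simp add: G_def mult_ac)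
  qed
  finally show "has_bochner_integral lborel
      (\<lambda>\<omega>. c_transform n (\<lambda>t. gauss n t ^ k) \<omega> * c_transform n (\<lambda>t. gauss n t ^ l) \<omega>) G" .
qed

lemma c_transform_gauss_poly_isometry:
  assumes "n \<ge> 1"
  shows "integrable lborel (\<lambda>t. (gauss_poly n q t)\<^sup>2)"
    and "has_bochner_integral lborel (\<lambda>\<omega>. (c_transform n (gauss_poly n q) \<omega>)\<^sup>2) (\<integral>t. (gauss_poly n q t)\<^sup>2 \<partial>lborel)"
proof -
  let ?G = "\<lambda>k l. Gamma (1 / (2 * real n)) * (real (Suc k) + real (Suc l)) powr (- 1 / (2 * real n)) / real n"
  let ?c = "\<lambda>k. complex_of_real (coeff q k)"
  let ?S = "\<Sum>k\<le>degree q. \<Sum>l\<le>degree q. Re (?c k * cnj (?c l)) * ?G k l"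
  have "has_bochner_integral lborel (\<lambda>t. (cmod (\<Sum>k\<le>degree q. ?c k * complex_of_real (gauss n t ^ Suc k)))\<^sup>2) ?S"
    by (intro has_bochner_integral_cmod_sum_square c_transform_gauss_power_inner assms) auto
  moreover have "(cmod (\<Sum>k\<le>degree q. ?c k * complex_of_real (gauss n t ^ Suc k)))\<^sup>2 = (gauss_poly n q t)\<^sup>2" for t
    unfolding gauss_poly_eq_sum of_real_mult[symmetric] of_real_sum[symmetric] norm_of_real power2_abs ..
  ultimately have P: "has_bochner_integral lborel (\<lambda>t. (gauss_poly n q t)\<^sup>2) ?S" by simp
  have "has_bochner_integral lborel
      (\<lambda>\<omega>. (cmod (\<Sum>k\<le>degree q. ?c k * complex_of_real (c_transform n (\<lambda>t. gauss n t ^ Suc k) \<omega>)))\<^sup>2) ?S"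
    by (intro has_bochner_integral_cmod_sum_square c_transform_gauss_power_inner assms) auto
  moreover have "(cmod (\<Sum>k\<le>degree q. ?c k * complex_of_real (c_transform n (\<lambda>t. gauss n t ^ Suc k) \<omega>)))\<^sup>2
      = (c_transform n (gauss_poly n q) \<omega>)\<^sup>2" for \<omega>
    unfolding c_transform_gauss_poly[OF assms]
    unfolding of_real_mult[symmetric] of_real_sum[symmetric] norm_of_real power2_abs ..
  ultimately have "has_bochner_integral lborel (\<lambda>\<omega>. (c_transform n (gauss_poly n q) \<omega>)\<^sup>2) ?S" by simp
  with P show "integrable lborel (\<lambda>t. (gauss_poly n q t)\<^sup>2)"
    and "has_bochner_integral lborel (\<lambda>\<omega>. (c_transform n (gauss_poly n q) \<omega>)\<^sup>2) (\<integral>t. (gauss_poly n q t)\<^sup>2 \<partial>lborel)"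
    by (simp_all only: has_bochner_integral_iff)
qed

text \<open>Mean square convergence implies convergence of norms. The cross term is split by Young's
  inequality with a weight that varies with m, so that all three resulting error terms vanish in the
  limit.\<close>

lemma square_integrals_tendsto:
  fixes f :: "'a \<Rightarrow> real" and g :: "nat \<Rightarrow> 'a \<Rightarrow> real"
  assumes [measurable]: "f \<in> borel_measurable M" "\<And>m. g m \<in> borel_measurable M"
    and g2: "\<And>m. integrable M (\<lambda>x. (g m x)\<^sup>2)"
    and d2: "\<And>m. integrable M (\<lambda>x. (f x - g m x)\<^sup>2)"
    and lim: "(\<lambda>m. \<integral>x. (f x - g m x)\<^sup>2 \<partial>M) \<longlonglongrightarrow> 0"
  shows "integrable M (\<lambda>x. (f x)\<^sup>2)"
    and "(\<lambda>m. \<integral>x. (g m x)\<^sup>2 \<partial>M) \<longlonglongrightarrow> (\<integral>x. (f x)\<^sup>2 \<partial>M)"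
proof -
  have dom: "integrable M (\<lambda>x. 2 * (g 0 x)\<^sup>2 + 2 * (f x - g 0 x)\<^sup>2)"
    using g2 d2 by simp
  have "(f x)\<^sup>2 \<le> 2 * (g 0 x)\<^sup>2 + 2 * (f x - g 0 x)\<^sup>2" for x
    using zero_le_power2[of "g 0 x - (f x - g 0 x)"] by (simp add: power2_eq_square algebra_simps)
  then show f2: "integrable M (\<lambda>x. (f x)\<^sup>2)"
    by (intro Bochner_Integration.integrable_bound[OF dom]) auto
  define d where "d m = (\<integral>x. (f x - g m x)\<^sup>2 \<partial>M)" for m
  \<comment> \<open>The weight in Young's inequality, close to the optimal order sqrt (d m): both
    \<open>e m\<close> and \<open>d m / e m\<close> must tend to 0. The summand 1/(m+1) keeps it
    positive when \<open>d m\<close> is 0.\<close>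
  define e where "e m = sqrt (d m + 1 / real (Suc m))" for m
  define A where "A = (\<integral>x. (f x)\<^sup>2 \<partial>M)"
  have d0: "d m \<ge> 0" for m by (simp add: d_def)
  have e0: "e m > 0" for m using d0[of m] by (simp add: e_def add_nonneg_pos)
  have de: "d m / e m \<le> e m" for m
  proof -
    have "d m \<le> e m * e m" using d0[of m] by (simp add: e_def)
    then show ?thesis using e0[of m] by (simp add: field_simps)
  qed
  have bound: "\<bar>(\<integral>x. (g m x)\<^sup>2 \<partial>M) - A\<bar> \<le> d m + e m * A + e m" for m
  proof -
    have pt: "\<bar>(g m x)\<^sup>2 - (f x)\<^sup>2\<bar> \<le> (f x - g m x)\<^sup>2 + e m * (f x)\<^sup>2 + (f x - g m x)\<^sup>2 / e m" for x
    proof -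
      have young: "\<bar>2 * (u * v)\<bar> \<le> e m * u\<^sup>2 + v\<^sup>2 / e m" for u v :: real
      proof -
        have "0 \<le> (e m * u - v)\<^sup>2 / e m" "0 \<le> (e m * u + v)\<^sup>2 / e m" using e0[of m] by auto
        moreover have "(e m * u - v)\<^sup>2 / e m = e m * u\<^sup>2 + v\<^sup>2 / e m - 2 * (u * v)"
          "(e m * u + v)\<^sup>2 / e m = e m * u\<^sup>2 + v\<^sup>2 / e m + 2 * (u * v)"
          using e0[of m] by (simp_all add: power2_eq_square field_simps)
        ultimately show ?thesis by linarith
      qed
      have "(g m x)\<^sup>2 - (f x)\<^sup>2 = (f x - g m x)\<^sup>2 - 2 * (f x * (f x - g m x))"
        by (simp add: power2_eq_square algebra_simps)
      then show ?thesis using young[of "f x" "f x - g m x"] zero_le_power2[of "f x - g m x"] by linarith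
    qed
    have "\<bar>(\<integral>x. (g m x)\<^sup>2 \<partial>M) - A\<bar> = \<bar>\<integral>x. (g m x)\<^sup>2 - (f x)\<^sup>2 \<partial>M\<bar>"
      using f2 g2 by (simp add: A_def)
    also have "\<dots> \<le> (\<integral>x. \<bar>(g m x)\<^sup>2 - (f x)\<^sup>2\<bar> \<partial>M)" by (rule integral_abs_bound)
    also have "\<dots> \<le> (\<integral>x. (f x - g m x)\<^sup>2 + e m * (f x)\<^sup>2 + (f x - g m x)\<^sup>2 / e m \<partial>M)"
      using f2 g2 d2 pt by (intro integral_mono) auto
    also have "\<dots> = d m + e m * A + d m / e m"
      using f2 d2 by (simp add: d_def A_def)
    finally show ?thesis using de[of m] by linarith
  qed
  have d_lim: "d \<longlonglongrightarrow> 0" using lim by (simp only: d_def[abs_def])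
  have "(\<lambda>m. 1 / real (Suc m)) \<longlonglongrightarrow> 0"
    using LIMSEQ_inverse_real_of_nat by (simp only: inverse_eq_divide)
  from tendsto_real_sqrt[OF tendsto_add[OF d_lim this]]
  have e_lim: "e \<longlonglongrightarrow> 0" by (simp add: e_def[abs_def])
  have "(\<lambda>m. d m + e m * A + e m) \<longlonglongrightarrow> 0 + 0 * A + 0"
    by (intro tendsto_add tendsto_mult d_lim e_lim tendsto_const)
  then have "(\<lambda>m. d m + e m * A + e m) \<longlonglongrightarrow> 0" by simp
  then have "(\<lambda>m. (\<integral>x. (g m x)\<^sup>2 \<partial>M) - A) \<longlonglongrightarrow> 0"
    by (rule Lim_null_comparison[OF always_eventually, rotated]) (simp add: bound)
  then show "(\<lambda>m. \<integral>x. (g m x)\<^sup>2 \<partial>M) \<longlonglongrightarrow> (\<integral>x. (f x)\<^sup>2 \<partial>M)"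
    unfolding A_def[symmetric] by (rule LIM_zero_cancel)
qed

text \<open>A single bound M serves twice: it dominates the approximants in mean square, and for
  each fixed \<omega> it dominates them under the kernel c_n.\<close>

definition gauss_approximable :: "nat \<Rightarrow> (real \<Rightarrow> real) \<Rightarrow> bool" where
  "gauss_approximable n f \<longleftrightarrow> (\<exists>q M. (\<forall>m t. \<bar>gauss_poly n (q m) t\<bar> \<le> M * gauss n t)
     \<and> (\<forall>t. (\<lambda>m. gauss_poly n (q m) t) \<longlonglongrightarrow> f t))"

text \<open>The transforms of the approximants converge pointwise, so Fatou's lemma gives only an
  inequality, applied to the differences L - Q m rather than to L. This is enough for mean square
  convergence; the equality of norms then follows because P m and Q m have equal norms and both
  sequences of norms converge.\<close>

lemma c_transform_isometry:
  assumes "n \<ge> 1" "gauss_approximable n f"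
  shows "f \<in> borel_measurable borel"
    and "integrable lborel (\<lambda>t. c_fun n (\<omega> * t) * f t)"
    and "integrable lborel (\<lambda>t. (f t)\<^sup>2)"
    and "has_bochner_integral lborel (\<lambda>\<omega>. (c_transform n f \<omega>)\<^sup>2) (\<integral>t. (f t)\<^sup>2 \<partial>lborel)"
proof -
  from assms(2) obtain q M where bound: "\<And>m t. \<bar>gauss_poly n (q m) t\<bar> \<le> M * gauss n t"
    and lim: "\<And>t. (\<lambda>m. gauss_poly n (q m) t) \<longlonglongrightarrow> f t"
    unfolding gauss_approximable_def by blast
  define P where "P m = gauss_poly n (q m)" for m
  have [measurable]: "P m \<in> borel_measurable borel" for m unfolding P_def by measurable
  have bound: "\<bar>P m t\<bar> \<le> M * gauss n t" and lim: "(\<lambda>m. P m t) \<longlonglongrightarrow> f t" for m t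
    using bound lim by (auto simp: P_def)
  show meas [measurable]: "f \<in> borel_measurable borel"
    by (rule borel_measurable_LIMSEQ_real[OF lim]) measurable
  have fbound: "\<bar>f t\<bar> \<le> M * gauss n t" for t
    by (rule LIMSEQ_le_const2[OF tendsto_rabs[OF lim]]) (use bound in auto)
  show "integrable lborel (\<lambda>t. c_fun n (\<omega> * t) * f t)"
    by (rule integrable_c_fun_dominated[OF assms(1) meas fbound])
  have M: "0 \<le> M * gauss n t" for t using abs_ge_zero fbound by (rule order_trans)
  \<comment> \<open>The factor 2 allows differences of two functions bounded by M times
    \<open>gauss n\<close>, so one dominating function covers f, P k - P m and f - P m.\<close>
  have sq: "x\<^sup>2 \<le> (2 * M)\<^sup>2 * gauss n t ^ 2" if "\<bar>x\<bar> \<le> 2 * (M * gauss n t)" for x t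
    using power_mono[OF that, of 2] by (simp add: power_mult_distrib)
  have dom: "integrable lborel (\<lambda>t. (2 * M)\<^sup>2 * gauss n t ^ 2)"
    by (intro integrable_mult_right integrable_gauss_power assms(1)) simp
  have f2: "integrable lborel (\<lambda>t. (f t)\<^sup>2)"
  proof (rule Bochner_Integration.integrable_bound[OF dom])
    show "AE t in lborel. norm ((f t)\<^sup>2) \<le> norm ((2 * M)\<^sup>2 * gauss n t ^ 2)"
    proof (intro AE_I2)
      fix t
      have "\<bar>f t\<bar> \<le> 2 * (M * gauss n t)" using fbound[of t] M[of t] by linarith
      from sq[OF this] show "norm ((f t)\<^sup>2) \<le> norm ((2 * M)\<^sup>2 * gauss n t ^ 2)" by simp
    qed
  qed measurable
  then show "integrable lborel (\<lambda>t. (f t)\<^sup>2)" .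
  have dist_lim: "(\<lambda>k. \<integral>t. (P k t - P m t)\<^sup>2 \<partial>lborel) \<longlonglongrightarrow> (\<integral>t. (f t - P m t)\<^sup>2 \<partial>lborel)" for m
  proof (rule integral_dominated_convergence[OF _ _ dom])
    show "AE t in lborel. (\<lambda>k. (P k t - P m t)\<^sup>2) \<longlonglongrightarrow> (f t - P m t)\<^sup>2"
      by (intro AE_I2 tendsto_intros lim)
    show "AE t in lborel. norm ((P k t - P m t)\<^sup>2) \<le> (2 * M)\<^sup>2 * gauss n t ^ 2" for k
    proof (intro AE_I2)
      fix t
      have "\<bar>P k t - P m t\<bar> \<le> 2 * (M * gauss n t)" using bound[of k t] bound[of m t] by linarith
      from sq[OF this] show "norm ((P k t - P m t)\<^sup>2) \<le> (2 * M)\<^sup>2 * gauss n t ^ 2" by simp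
    qed
  qed measurable
  have d_lim: "(\<lambda>m. \<integral>t. (f t - P m t)\<^sup>2 \<partial>lborel) \<longlonglongrightarrow> (\<integral>t. (f t - f t)\<^sup>2 \<partial>lborel)"
  proof (rule integral_dominated_convergence[OF _ _ dom])
    show "AE t in lborel. (\<lambda>m. (f t - P m t)\<^sup>2) \<longlonglongrightarrow> (f t - f t)\<^sup>2"
      by (intro AE_I2 tendsto_intros lim)
    show "AE t in lborel. norm ((f t - P m t)\<^sup>2) \<le> (2 * M)\<^sup>2 * gauss n t ^ 2" for m
    proof (intro AE_I2)
      fix t
      have "\<bar>f t - P m t\<bar> \<le> 2 * (M * gauss n t)" using fbound[of t] bound[of m t] by linarith
      from sq[OF this] show "norm ((f t - P m t)\<^sup>2) \<le> (2 * M)\<^sup>2 * gauss n t ^ 2" by simp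
    qed
  qed measurable
  then have d_lim: "(\<lambda>m. \<integral>t. (f t - P m t)\<^sup>2 \<partial>lborel) \<longlonglongrightarrow> 0" by simp

  define L where "L = c_transform n f"
  define Q where "Q m = c_transform n (P m)" for m
  have [measurable]: "L \<in> borel_measurable borel" "Q m \<in> borel_measurable borel" for m
    unfolding L_def Q_def by (intro c_transform_borel; measurable)+
  have Q2: "has_bochner_integral lborel (\<lambda>\<omega>. (Q m \<omega>)\<^sup>2) (\<integral>t. (P m t)\<^sup>2 \<partial>lborel)" for m
    unfolding Q_def P_def by (rule c_transform_gauss_poly_isometry[OF assms(1)])
  have Q_lim: "(\<lambda>m. Q m \<omega>) \<longlonglongrightarrow> L \<omega>" for \<omega>
    unfolding Q_def L_def c_transform_def
  proof (rule integral_dominated_convergence)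
    show "integrable lborel (\<lambda>t. \<bar>c_fun n (\<omega> * t) * (M * gauss n t)\<bar>)"
      by (intro integrable_abs integrable_c_fun_dominated[OF assms(1), of _ M]) (use M in auto)
    show "AE t in lborel. (\<lambda>m. c_fun n (\<omega> * t) * P m t) \<longlonglongrightarrow> c_fun n (\<omega> * t) * f t"
      by (intro AE_I2 tendsto_intros lim)
    have "\<bar>c_fun n (\<omega> * t) * P m t\<bar> \<le> \<bar>c_fun n (\<omega> * t) * (M * gauss n t)\<bar>" for m t
      unfolding abs_mult[of "c_fun n (\<omega> * t)"] using bound[of m t] by (intro mult_left_mono) auto
    then show "AE t in lborel. norm (c_fun n (\<omega> * t) * P m t) \<le> \<bar>c_fun n (\<omega> * t) * (M * gauss n t)\<bar>" for m
      by (intro AE_I2) simp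
  qed measurable
  \<comment> \<open>The difference of two approximants is again a Gaussian polynomial, to which the
    isometry already proved applies.\<close>
  have Q_diff: "has_bochner_integral lborel (\<lambda>\<omega>. (Q k \<omega> - Q m \<omega>)\<^sup>2) (\<integral>t. (P k t - P m t)\<^sup>2 \<partial>lborel)" for k m
  proof -
    have diff: "gauss_poly n (q k - q m) = (\<lambda>t. P k t - P m t)"
      by (rule ext) (simp add: P_def gauss_poly_def algebra_simps)
    have "c_transform n (gauss_poly n (q k - q m)) \<omega> = Q k \<omega> - Q m \<omega>" for \<omega>
      unfolding diff Q_def c_transform_def P_def
      using integrable_c_fun_gauss_poly[OF assms(1)] by (simp add: right_diff_distrib)
    then show ?thesis
      using c_transform_gauss_poly_isometry(2)[OF assms(1), of "q k - q m"] unfolding diff by simp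
  qed
  have fatou: "(\<integral>\<^sup>+\<omega>. ennreal ((L \<omega> - Q m \<omega>)\<^sup>2) \<partial>lborel) \<le> ennreal (\<integral>t. (f t - P m t)\<^sup>2 \<partial>lborel)" for m
  proof -
    have "(\<integral>\<^sup>+\<omega>. ennreal ((L \<omega> - Q m \<omega>)\<^sup>2) \<partial>lborel) = (\<integral>\<^sup>+\<omega>. liminf (\<lambda>k. ennreal ((Q k \<omega> - Q m \<omega>)\<^sup>2)) \<partial>lborel)"
      by (intro nn_integral_cong lim_imp_Liminf[symmetric] tendsto_intros Q_lim) simp
    also have "\<dots> \<le> liminf (\<lambda>k. \<integral>\<^sup>+\<omega>. ennreal ((Q k \<omega> - Q m \<omega>)\<^sup>2) \<partial>lborel)"
      by (rule nn_integral_liminf) measurable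
    also have "(\<lambda>k. \<integral>\<^sup>+\<omega>. ennreal ((Q k \<omega> - Q m \<omega>)\<^sup>2) \<partial>lborel) = (\<lambda>k. ennreal (\<integral>t. (P k t - P m t)\<^sup>2 \<partial>lborel))"
      using Q_diff by (subst nn_integral_eq_integral) (auto simp: has_bochner_integral_iff)
    also have "liminf \<dots> = ennreal (\<integral>t. (f t - P m t)\<^sup>2 \<partial>lborel)"
      by (intro lim_imp_Liminf tendsto_ennrealI dist_lim) simp
    finally show ?thesis .
  qed
  have int: "integrable lborel (\<lambda>\<omega>. (L \<omega> - Q m \<omega>)\<^sup>2)" for m
    using order.strict_trans1[OF fatou ennreal_less_top]
    by (intro integrableI_nonneg) (auto simp: infinity_ennreal_def)
  have le: "(\<integral>\<omega>. (L \<omega> - Q m \<omega>)\<^sup>2 \<partial>lborel) \<le> (\<integral>t. (f t - P m t)\<^sup>2 \<partial>lborel)" for m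
    using fatou[of m] by (subst (asm) nn_integral_eq_integral[OF int]) auto
  have "(\<lambda>m. \<integral>\<omega>. (L \<omega> - Q m \<omega>)\<^sup>2 \<partial>lborel) \<longlonglongrightarrow> 0"
    by (rule tendsto_sandwich[OF _ _ tendsto_const d_lim]) (use le in \<open>auto intro!: always_eventually\<close>)
  note L_lim = square_integrals_tendsto[OF _ _ _ int this]
  have P2: "integrable lborel (\<lambda>t. (P m t)\<^sup>2)" and Q2i: "integrable lborel (\<lambda>\<omega>. (Q m \<omega>)\<^sup>2)" for m
    using Q2 c_transform_gauss_poly_isometry(1)[OF assms(1)] by (auto simp: P_def has_bochner_integral_iff)
  have fP: "integrable lborel (\<lambda>t. (f t - P m t)\<^sup>2)" for m
  proof (rule Bochner_Integration.integrable_bound[OF dom])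
    show "AE t in lborel. norm ((f t - P m t)\<^sup>2) \<le> norm ((2 * M)\<^sup>2 * gauss n t ^ 2)"
    proof (intro AE_I2)
      fix t
      have "\<bar>f t - P m t\<bar> \<le> 2 * (M * gauss n t)" using fbound[of t] bound[of m t] by linarith
      from sq[OF this] show "norm ((f t - P m t)\<^sup>2) \<le> norm ((2 * M)\<^sup>2 * gauss n t ^ 2)" by simp
    qed
  qed measurable
  have "(\<lambda>m. \<integral>\<omega>. (Q m \<omega>)\<^sup>2 \<partial>lborel) \<longlonglongrightarrow> (\<integral>\<omega>. (L \<omega>)\<^sup>2 \<partial>lborel)"
    by (rule L_lim(2)) (use Q2i in auto)
  moreover have "(\<lambda>m. \<integral>t. (P m t)\<^sup>2 \<partial>lborel) \<longlonglongrightarrow> (\<integral>t. (f t)\<^sup>2 \<partial>lborel)"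
    by (rule square_integrals_tendsto(2)[OF _ _ P2 fP d_lim]) auto
  moreover have "(\<integral>\<omega>. (Q m \<omega>)\<^sup>2 \<partial>lborel) = (\<integral>t. (P m t)\<^sup>2 \<partial>lborel)" for m
    using Q2[of m] by (simp add: has_bochner_integral_iff)
  ultimately have "(\<integral>\<omega>. (L \<omega>)\<^sup>2 \<partial>lborel) = (\<integral>t. (f t)\<^sup>2 \<partial>lborel)"
    using LIMSEQ_unique by simp
  moreover have "integrable lborel (\<lambda>\<omega>. (L \<omega>)\<^sup>2)"
    by (rule L_lim(1)) (use Q2i in auto)
  ultimately show "has_bochner_integral lborel (\<lambda>\<omega>. (c_transform n f \<omega>)\<^sup>2) (\<integral>t. (f t)\<^sup>2 \<partial>lborel)"
    by (simp add: L_def has_bochner_integral_iff)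
qed

section \<open>Even step functions\<close>

lemma gauss_approximable_add:
  assumes "gauss_approximable n f" "gauss_approximable n g"
  shows "gauss_approximable n (\<lambda>t. f t + g t)"
proof -
  from assms(1) obtain p A where p: "\<And>m t. \<bar>gauss_poly n (p m) t\<bar> \<le> A * gauss n t"
    "\<And>t. (\<lambda>m. gauss_poly n (p m) t) \<longlonglongrightarrow> f t"
    unfolding gauss_approximable_def by blast
  from assms(2) obtain q B where q: "\<And>m t. \<bar>gauss_poly n (q m) t\<bar> \<le> B * gauss n t"
    "\<And>t. (\<lambda>m. gauss_poly n (q m) t) \<longlonglongrightarrow> g t"
    unfolding gauss_approximable_def by blast
  have eq: "gauss_poly n (p m + q m) t = gauss_poly n (p m) t + gauss_poly n (q m) t" for m t
    by (simp add: gauss_poly_def distrib_left)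
  show ?thesis
    unfolding gauss_approximable_def
  proof (intro exI[of _ "\<lambda>m. p m + q m"] exI[of _ "A + B"] conjI allI)
    show "\<bar>gauss_poly n (p m + q m) t\<bar> \<le> (A + B) * gauss n t" for m t
      using p(1)[of m t] q(1)[of m t] abs_triangle_ineq[of "gauss_poly n (p m) t" "gauss_poly n (q m) t"]
      unfolding eq distrib_right by linarith
    show "(\<lambda>m. gauss_poly n (p m + q m) t) \<longlonglongrightarrow> f t + g t" for t
      unfolding eq by (intro tendsto_add p q)
  qed
qed

lemma gauss_approximable_scale:
  assumes "gauss_approximable n f"
  shows "gauss_approximable n (\<lambda>t. c * f t)"
proof -
  from assms obtain p A where p: "\<And>m t. \<bar>gauss_poly n (p m) t\<bar> \<le> A * gauss n t"
    "\<And>t. (\<lambda>m. gauss_poly n (p m) t) \<longlonglongrightarrow> f t"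
    unfolding gauss_approximable_def by blast
  have eq: "gauss_poly n (smult c (p m)) t = c * gauss_poly n (p m) t" for m t
    by (simp add: gauss_poly_def)
  show ?thesis
    unfolding gauss_approximable_def
  proof (intro exI[of _ "\<lambda>m. smult c (p m)"] exI[of _ "\<bar>c\<bar> * A"] conjI allI)
    show "\<bar>gauss_poly n (smult c (p m)) t\<bar> \<le> \<bar>c\<bar> * A * gauss n t" for m t
      unfolding eq abs_mult mult.assoc by (intro mult_left_mono p) simp
    show "(\<lambda>m. gauss_poly n (smult c (p m)) t) \<longlonglongrightarrow> c * f t" for t
      unfolding eq by (intro tendsto_mult tendsto_const p)
  qed
qed

lemma gauss_approximable_0: "gauss_approximable n (\<lambda>t. 0)"
  unfolding gauss_approximable_def
  by (intro exI[of _ "\<lambda>m. 0"] exI[of _ 0]) (simp add: gauss_poly_def)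

lemma gauss_approximable_sum:
  "finite K \<Longrightarrow> (\<And>k. k \<in> K \<Longrightarrow> gauss_approximable n (f k)) \<Longrightarrow> gauss_approximable n (\<lambda>t. \<Sum>k\<in>K. f k t)"
  by (induction K rule: finite_induct) (auto intro: gauss_approximable_0 gauss_approximable_add)

text \<open>In the variable y = exp(-t^(2n)) the interval becomes {y0..1}; its indicator divided by y is a
  pointwise limit of uniformly bounded continuous ramps on the unit interval, hence of polynomials.\<close>
lemma gauss_approximable_interval:
  assumes "n \<ge> 1" "0 \<le> c"
  shows "gauss_approximable n (indicator {-c..c})"
proof -
  define y0 where "y0 = gauss n c"
  have y0: "0 < y0" by (simp add: y0_def gauss_pos)
  \<comment> \<open>The denominator \<open>max y y0\<close> agrees with y where the limit is
    nonzero; below y0 it keeps the quotient continuous and bounded by 1/y0.\<close>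
  define g where "g m y = max 0 (min 1 (1 + real m * (y - y0))) / max y y0" for m :: nat and y
  have "\<exists>q. \<forall>y\<in>{0..1}. \<bar>g m y - poly q y\<bar> < 1 / real (Suc m)" for m
  proof -
    have "continuous_on {0..1} (g m)"
      unfolding g_def using y0 by (intro continuous_intros) auto
    from Stone_Weierstrass_real_polynomial_function[OF _ this, of "1 / real (Suc m)"]
    obtain h where h: "real_polynomial_function h" "\<And>y. y \<in> {0..1} \<Longrightarrow> \<bar>g m y - h y\<bar> < 1 / real (Suc m)"
      by auto
    from h(1) obtain a N where "h = (\<lambda>y. \<Sum>i\<le>N. a i * y ^ i)"
      unfolding real_polynomial_function_iff_sum by blast
    then have "h y = poly (\<Sum>i\<le>N. monom (a i) i) y" for y
      by (simp add: poly_sum poly_monom)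
    with h(2) show ?thesis by (intro exI[of _ "\<Sum>i\<le>N. monom (a i) i"]) simp
  qed
  then obtain q where q: "\<And>m y. y \<in> {0..1} \<Longrightarrow> \<bar>g m y - poly (q m) y\<bar> < 1 / real (Suc m)"
    by metis
  have g_bound: "\<bar>g m y\<bar> \<le> 1 / y0" if "0 < y" for m y
    unfolding g_def abs_divide using y0 that by (intro frac_le) auto
  have y: "gauss n t \<in> {0..1}" for t
    using gauss_pos[of n t] gauss_le_1[of n t] by auto
  show ?thesis
    unfolding gauss_approximable_def
  proof (intro exI[of _ q] exI[of _ "1 / y0 + 1"] conjI allI)
    fix m t
    have "1 / real (Suc m) \<le> 1" by simp
    then have "\<bar>poly (q m) (gauss n t)\<bar> \<le> 1 / y0 + 1"
      using q[OF y, of m t] g_bound[OF gauss_pos, of m n t] by linarith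
    then have "gauss n t * \<bar>poly (q m) (gauss n t)\<bar> \<le> gauss n t * (1 / y0 + 1)"
      by (intro mult_left_mono less_imp_le[OF gauss_pos])
    then show "\<bar>gauss_poly n (q m) t\<bar> \<le> (1 / y0 + 1) * gauss n t"
      by (simp only: gauss_poly_def abs_mult abs_of_pos[OF gauss_pos] mult.commute)
  next
    fix t
    define y where "y = gauss n t"
    have yp: "0 < y" by (simp add: y_def gauss_pos)
    have iff: "t \<in> {-c..c} \<longleftrightarrow> y0 \<le> y"
    proof -
      have "y0 \<le> y \<longleftrightarrow> \<bar>t\<bar> ^ (2 * n) \<le> c ^ (2 * n)"
        by (simp add: y0_def y_def gauss_def power_even_abs)
      also have "\<dots> \<longleftrightarrow> \<bar>t\<bar> \<le> c"
        using assms by (intro power_mono_iff) auto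
      finally show ?thesis by (auto simp: abs_le_iff)
    qed
    have g_lim: "(\<lambda>m. g m y) \<longlonglongrightarrow> indicator {-c..c} t / y"
    proof (cases "y0 \<le> y")
      case True
      then have "g m y = indicator {-c..c} t / y" for m
        using iff by (simp add: g_def max_def min_def)
      then show ?thesis by simp
    next
      case False
      then have d: "0 < y0 - y" by simp
      obtain N where N: "1 < real N * (y0 - y)"
        using reals_Archimedean3[OF d] by blast
      have "g m y = 0" if "m \<ge> N" for m
      proof -
        have "real N * (y0 - y) \<le> real m * (y0 - y)" using that d by (intro mult_right_mono) auto
        then have "1 + real m * (y - y0) \<le> 0" using N by (simp add: algebra_simps)
        then show ?thesis by (simp add: g_def)
      qed
      then have "(\<lambda>m. g m y) \<longlonglongrightarrow> 0"
        by (intro tendsto_eventually eventually_sequentiallyI[of N])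
      then show ?thesis using False iff by simp
    qed
    have "(\<lambda>m. g m y - poly (q m) y) \<longlonglongrightarrow> 0"
    proof (rule Lim_null_comparison[OF always_eventually])
      show "\<forall>m. norm (g m y - poly (q m) y) \<le> 1 / real (Suc m)"
        using q[OF y] by (simp add: y_def less_imp_le)
      show "(\<lambda>m. 1 / real (Suc m)) \<longlonglongrightarrow> 0"
        using LIMSEQ_inverse_real_of_nat by (simp only: inverse_eq_divide)
    qed
    from tendsto_diff[OF g_lim this]
    have "(\<lambda>m. y * poly (q m) y) \<longlonglongrightarrow> y * (indicator {-c..c} t / y)"
      by (intro tendsto_mult tendsto_const) simp
    then show "(\<lambda>m. gauss_poly n (q m) t) \<longlonglongrightarrow> indicator {-c..c} t"
      using yp by (simp add: gauss_poly_def y_def)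
  qed
qed

section \<open>Symmetrization of intervals\<close>

definition signed_interval :: "real \<Rightarrow> real \<Rightarrow> real" where
  "signed_interval c t = sgn c * indicator {-\<bar>c\<bar>..\<bar>c\<bar>} t"

text \<open>The sign of c unifies the cases: for 0 < a < b the symmetric intervals are subtracted,
  for a < 0 < b they are added, and for a < b < 0 the difference is reversed.\<close>

lemma indicator_symmetrized:
  assumes "a < b" "t \<notin> {a, - a, b, - b}"
  shows "indicator {a..b} t + indicator {a..b} (- t) = signed_interval b t - signed_interval a t"
  using assms by (auto simp: signed_interval_def indicator_def sgn_if)

lemma gauss_approximable_signed_interval:
  "n \<ge> 1 \<Longrightarrow> gauss_approximable n (signed_interval c)"
  unfolding signed_interval_def[abs_def]
  by (rule gauss_approximable_scale, rule gauss_approximable_interval) auto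

text \<open>The single summands of an even step function need not be even. Averaging with the
  reflection makes each of them even off the endpoints, whence the factor 1/2; real and imaginary
  parts are separated because \<open>gauss_approximable\<close> concerns real functions.\<close>

lemma even_step_approximable:
  assumes "n \<ge> 1" "f \<in> V_plus j"
  obtains u v E where "gauss_approximable n u" "gauss_approximable n v" "finite E"
    "\<And>t. t \<notin> E \<Longrightarrow> f t = complex_of_real (u t) + \<i> * complex_of_real (v t)"
proof -
  from assms(2) have fV: "f \<in> V_space j" and even: "\<And>t. f (- t) = f t" by (auto simp: V_plus_def)
  obtain K c \<alpha> \<beta> where K: "finite (K :: int set)" "\<And>k. k \<in> K \<Longrightarrow> \<alpha> k < \<beta> k"
    and f: "f = (\<lambda>t. \<Sum>k\<in>K. c k * complex_of_real (indicator {\<alpha> k .. \<beta> k} t))"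
    by (rule V_space_stepE[OF fV]) (rule that)
  define S where "S k t = signed_interval (\<beta> k) t - signed_interval (\<alpha> k) t" for k t
  define u where "u t = (\<Sum>k\<in>K. Re (c k) / 2 * S k t)" for t
  define v where "v t = (\<Sum>k\<in>K. Im (c k) / 2 * S k t)" for t
  define E where "E = (\<Union>k\<in>K. {\<alpha> k, - \<alpha> k, \<beta> k, - \<beta> k})"
  have S: "gauss_approximable n (S k)" for k
  proof -
    have "gauss_approximable n (\<lambda>t. signed_interval (\<beta> k) t + (- 1) * signed_interval (\<alpha> k) t)"
      by (rule gauss_approximable_add[OF _ gauss_approximable_scale])
         (rule gauss_approximable_signed_interval[OF assms(1)])+
    then show ?thesis by (simp add: S_def[abs_def])
  qed
  show ?thesis
  proof
    show "gauss_approximable n u" "gauss_approximable n v"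
      unfolding u_def[abs_def] v_def[abs_def]
      by (rule gauss_approximable_sum[OF K(1)], rule gauss_approximable_scale, rule S)+
    show "finite E" using K by (simp add: E_def)
    fix t assume t: "t \<notin> E"
    have "f t = (f t + f (- t)) / 2" by (simp add: even)
    also have "\<dots> = (\<Sum>k\<in>K. c k / 2 * complex_of_real (indicator {\<alpha> k .. \<beta> k} t + indicator {\<alpha> k .. \<beta> k} (- t)))"
      by (simp add: f sum_divide_distrib distrib_left add_divide_distrib flip: sum.distrib)
    also have "\<dots> = (\<Sum>k\<in>K. c k / 2 * complex_of_real (S k t))"
    proof (intro sum.cong refl)
      fix k assume k: "k \<in> K"
      have "indicator {\<alpha> k .. \<beta> k} t + indicator {\<alpha> k .. \<beta> k} (- t) = S k t"
        unfolding S_def using t k by (intro indicator_symmetrized K) (auto simp: E_def)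
      then show "c k / 2 * complex_of_real (indicator {\<alpha> k .. \<beta> k} t + indicator {\<alpha> k .. \<beta> k} (- t))
         = c k / 2 * complex_of_real (S k t)" by (simp only:)
    qed
    also have "\<dots> = complex_of_real (u t) + \<i> * complex_of_real (v t)"
      by (simp add: complex_eq_iff u_def v_def)
    finally show "f t = complex_of_real (u t) + \<i> * complex_of_real (v t)" .
  qed
qed

section \<open>Complex-valued functions and assembly\<close>

definition c_transform_complex :: "nat \<Rightarrow> (real \<Rightarrow> complex) \<Rightarrow> real \<Rightarrow> complex" where
  "c_transform_complex n f \<omega> = (\<integral>t. complex_of_real (c_fun n (\<omega> * t)) * f t \<partial>lborel)"

lemma c_transform_complex_minus: "c_transform_complex n f (- \<omega>) = c_transform_complex n f \<omega>"
  by (simp add: c_transform_complex_def c_fun_minus)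

lemma c_transform_complex_cong_finite:
  assumes "finite E" "\<And>t. t \<notin> E \<Longrightarrow> f t = g t"
  shows "c_transform_complex n f = c_transform_complex n g"
  unfolding c_transform_complex_def[abs_def]
  by (intro ext integral_discrete_difference[of E]) (use assms in \<open>auto simp: countable_finite\<close>)

text \<open>The kernel is real, so real and imaginary parts transform separately and their squares
  add up on both sides.\<close>

lemma c_transform_complex_isometry:
  assumes "n \<ge> 1" "f \<in> V_plus j"
  shows "c_transform_complex n f \<in> borel_measurable borel"
    and "has_bochner_integral lborel (\<lambda>\<omega>. (cmod (c_transform_complex n f \<omega>))\<^sup>2) (\<integral>t. (cmod (f t))\<^sup>2 \<partial>lborel)"
proof -
  obtain u v E where u: "gauss_approximable n u" and v: "gauss_approximable n v" and E: "finite E"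
    and f: "\<And>t. t \<notin> E \<Longrightarrow> f t = complex_of_real (u t) + \<i> * complex_of_real (v t)"
    by (rule even_step_approximable[OF assms]) (rule that)
  note iso_u = c_transform_isometry[OF assms(1) u] and iso_v = c_transform_isometry[OF assms(1) v]
  have F: "c_transform_complex n f \<omega> = complex_of_real (c_transform n u \<omega>) + \<i> * complex_of_real (c_transform n v \<omega>)" for \<omega>
  proof -
    have "c_transform_complex n f \<omega> = (\<integral>t. complex_of_real (c_fun n (\<omega> * t) * u t) + \<i> * complex_of_real (c_fun n (\<omega> * t) * v t) \<partial>lborel)"
    proof -
      have "c_transform_complex n f \<omega>
          = c_transform_complex n (\<lambda>t. complex_of_real (u t) + \<i> * complex_of_real (v t)) \<omega>"
        by (rule fun_cong[OF c_transform_complex_cong_finite[OF E]]) (rule f)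
      then show ?thesis by (simp add: c_transform_complex_def distrib_left mult.left_commute)
    qed
    also have "\<dots> = (\<integral>t. complex_of_real (c_fun n (\<omega> * t) * u t) \<partial>lborel) + \<i> * (\<integral>t. complex_of_real (c_fun n (\<omega> * t) * v t) \<partial>lborel)"
      using iso_u(2)[of \<omega>] iso_v(2)[of \<omega>]
      by (subst Bochner_Integration.integral_add) (auto simp del: of_real_mult intro!: integrable_of_real)
    finally show ?thesis
      by (simp only: integral_complex_of_real c_transform_def)
  qed
  have [measurable]: "c_transform n u \<in> borel_measurable borel" "c_transform n v \<in> borel_measurable borel"
    by (intro c_transform_borel iso_u(1) iso_v(1))+
  show "c_transform_complex n f \<in> borel_measurable borel"
    unfolding F[abs_def] by measurable
  have sq: "(cmod (complex_of_real a + \<i> * complex_of_real b))\<^sup>2 = a\<^sup>2 + b\<^sup>2" for a b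
    by (simp add: cmod_power2)
  have "(\<integral>t. (cmod (f t))\<^sup>2 \<partial>lborel) = (\<integral>t. (u t)\<^sup>2 + (v t)\<^sup>2 \<partial>lborel)"
    by (rule integral_discrete_difference[of E]) (use E f sq in \<open>auto simp: countable_finite\<close>)
  also have "\<dots> = (\<integral>t. (u t)\<^sup>2 \<partial>lborel) + (\<integral>t. (v t)\<^sup>2 \<partial>lborel)"
    using iso_u(3) iso_v(3) by (rule Bochner_Integration.integral_add)
  finally show "has_bochner_integral lborel (\<lambda>\<omega>. (cmod (c_transform_complex n f \<omega>))\<^sup>2) (\<integral>t. (cmod (f t))\<^sup>2 \<partial>lborel)"
    unfolding F sq using has_bochner_integral_add[OF iso_u(4) iso_v(4)] by simp
qed

lemma V_plus_step:
  assumes "f \<in> V_plus j"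
  obtains K :: "int set" and c \<alpha> \<beta> where "step_function K \<alpha> \<beta>" "f = step_function.step K c \<alpha> \<beta>"
proof -
  from assms have fV: "f \<in> V_space j" by (simp add: V_plus_def)
  obtain K c \<alpha> \<beta> where K: "finite (K :: int set)" "\<And>k. k \<in> K \<Longrightarrow> \<alpha> k < \<beta> k"
    and f: "f = (\<lambda>t. \<Sum>k\<in>K. c k * complex_of_real (indicator {\<alpha> k .. \<beta> k} t))"
    by (rule V_space_stepE[OF fV]) (rule that)
  have "step_function K \<alpha> \<beta>" using K by unfold_locales
  moreover have "f = step_function.step K c \<alpha> \<beta>"
    unfolding f by (rule ext) (simp add: step_function.step_def[OF \<open>step_function K \<alpha> \<beta>\<close>])
  ultimately show ?thesis by (rule that)
qed

text \<open>The element g is given through its components f and g2. The integrability claims give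
  the final equation its content, since the integral of a function that is not integrable is 0 by
  convention.\<close>

theorem theorem2:
  fixes n :: nat and j :: int and f g2 :: "real \<Rightarrow> complex"
  assumes "n \<ge> 1"
    and "f \<in> V_plus j"
    and "g2 \<in> hilbert ` V_plus j"
  shows "integrable lborel (\<lambda>t. (cmod (f t + g2 t))\<^sup>2)
       \<and> integrable lborel (\<lambda>\<omega>. (cmod (Phi_op n f g2 \<omega>))\<^sup>2)
       \<and> (LINT \<omega> | lborel. (cmod (Phi_op n f g2 \<omega>))\<^sup>2) = (LINT t | lborel. (cmod (f t + g2 t))\<^sup>2)"
proof -
  from assms(3) obtain h where h: "h \<in> V_plus j" and g2: "g2 = hilbert h" by blast
  have even: "f (- t) = f t" "h (- t) = h t" for t
    using assms(2) h by (auto simp: V_plus_def)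
  obtain K :: "int set" and c \<alpha> \<beta> where "step_function K \<alpha> \<beta>" and f_step: "f = step_function.step K c \<alpha> \<beta>"
    using V_plus_step[OF assms(2)] .
  then interpret f: step_function K c \<alpha> \<beta> by simp
  obtain K' :: "int set" and c' \<alpha>' \<beta>' where "step_function K' \<alpha>' \<beta>'" and h_step: "h = step_function.step K' c' \<alpha>' \<beta>'"
    using V_plus_step[OF h] .
  then interpret h: step_function K' c' \<alpha>' \<beta>' by simp
  have f2: "integrable lborel (\<lambda>t. (cmod (f t))\<^sup>2)"
    using f.step_square_integral by (simp add: f_step has_bochner_integral_iff)
  have Hh2: "has_bochner_integral lborel (\<lambda>t. (cmod (g2 t))\<^sup>2) (\<integral>t. (cmod (h t))\<^sup>2 \<partial>lborel)"
    unfolding g2 h_step by (rule h.hilbert_step_square_integral)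
  have f_meas: "f \<in> borel_measurable borel" unfolding f_step by measurable
  have g2_meas: "g2 \<in> borel_measurable borel" unfolding g2 h_step by (rule h.hilbert_step_borel)
  have f_even: "AE x in lborel. f (- x) = f x" by (simp add: even)
  have g2_odd: "AE x in lborel. g2 (- x) = - g2 x"
    unfolding g2 h_step using even(2) by (intro h.hilbert_step_odd) (simp add: h_step)
  have g2_sq: "integrable lborel (\<lambda>t. (cmod (g2 t))\<^sup>2)"
    using Hh2 by (simp add: has_bochner_integral_iff)
  note g_sum = pythagoras_even_odd[OF f_meas g2_meas f_even g2_odd f2 g2_sq]

  define U where "U = c_transform_complex n f"
  define W where "W = c_transform_complex n h"
  \<comment> \<open>The minus sign comes from H(H h) = -h, inserted into the second integral of
    \<open>Phi_op\<close>.\<close>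
  define V where "V \<omega> = - \<i> * complex_of_real (sgn \<omega>) * W \<omega>" for \<omega>
  note iso_f = c_transform_complex_isometry[OF assms(1,2), folded U_def]
    and iso_h = c_transform_complex_isometry[OF assms(1) h, folded W_def]
  note [measurable] = iso_f(1) iso_h(1)
  have V_meas [measurable]: "V \<in> borel_measurable borel" unfolding V_def by measurable
  have Phi: "Phi_op n f g2 \<omega> = U \<omega> + V \<omega>" for \<omega>
  proof -
    have "c_transform_complex n (hilbert g2) = c_transform_complex n (\<lambda>t. - h t)"
      unfolding g2 h_step by (rule c_transform_complex_cong_finite[OF h.finite_jumps h.hilbert_hilbert_step])
    then have "c_transform_complex n (hilbert g2) \<omega> = - W \<omega>"
      by (simp add: W_def c_transform_complex_def)
    then show ?thesis
      by (simp add: Phi_op_def U_def V_def c_transform_complex_def)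
  qed
  \<comment> \<open>The moduli can differ at \<omega> = 0, where sgn vanishes.\<close>
  have AE_V: "AE \<omega> in lborel. (cmod (V \<omega>))\<^sup>2 = (cmod (W \<omega>))\<^sup>2"
    using AE_lborel_singleton[of "0::real"] by eventually_elim (simp add: V_def norm_mult sgn_if)
  have V2: "has_bochner_integral lborel (\<lambda>\<omega>. (cmod (V \<omega>))\<^sup>2) (\<integral>t. (cmod (h t))\<^sup>2 \<partial>lborel)"
    by (rule has_bochner_integral_cong_AE[THEN iffD2, OF _ _ AE_V iso_h(2)]) measurable
  have U_even: "AE x in lborel. U (- x) = U x" by (simp add: U_def c_transform_complex_minus)
  have V_odd: "AE x in lborel. V (- x) = - V x" by (simp add: V_def W_def c_transform_complex_minus)
  have "integrable lborel (\<lambda>\<omega>. (cmod (U \<omega>))\<^sup>2)" "integrable lborel (\<lambda>\<omega>. (cmod (V \<omega>))\<^sup>2)"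
    using iso_f V2 by (simp_all add: has_bochner_integral_iff)
  note pythagoras_even_odd[OF iso_f(1) V_meas U_even V_odd this]
  then show ?thesis
    using g_sum iso_f(2) V2 Hh2 by (simp add: Phi has_bochner_integral_iff)
qed

end
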